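(* Let $\mathcal K$ be one of the categories $\mathcal P$ or $\mathcal B$, let $m,n\in\mathbb N$, and let $\sigma\in\mathcal K_{nm}$ with $r=\operatorname{rank}(\sigma)$. Then $$\mathbb E(\mathcal K_{mn}^\sigma)=V(\sigma)\cup(P^\sigma\setminus D_r^\sigma).$$
   Context: $\mathbb N=\{0,1,2,\ldots\}$, $[n]=\{1,\ldots,n\}$ (with $[0]=\emptyset$), and $A'=\{a':a\in A\}$, $A''=\{a'':a\in A\}$ for $A\subseteq\mathbb N$. $\mathcal P_{mn}$ is the set of all set partitions of $[m]\cup[n]'$, and $\mathcal P=\bigcup_{m,n\in\mathbb N}\mathcal P_{mn}$. For $\alpha\in\mathcal P_{mn}$ and $\beta\in\mathcal P_{nk}$, the product $\alpha\beta\in\mathcal P_{mk}$ is formed as follows: identify partitions with graphs whose connected components are the blocks; let $\alpha_\downarrow$ be the graph on $[m]\cup[n]''$ obtained from $\alpha$ by renaming each $x'$ to $x''$, let $\beta^\uparrow$ be the graph on $[n]''\cup[k]'$ obtained from $\beta$ by renaming each $x\in[n]$ to $x''$, and let $\Pi(\alpha,\beta)$ be their union on $[m]\cup[n]''\cup[k]'$; two elements of $[m]\cup[k]'$ are in the same block of $\alpha\beta$ iff they are in the same component of $\Pi(\alpha,\beta)$. The rank of $\alpha\in\mathcal P_{mn}$ is the number of blocks meeting both $[m]$ and $[n]'$. $\mathcal B$ (Brauer category) consists of the partitions all of whose blocks have size $2$. $\mathcal K_{mn}=\mathcal K\cap\mathcal P_{mn}$. For $\sigma\in\mathcal K_{nm}$,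 $\mathcal K_{mn}^\sigma$ is the set $\mathcal K_{mn}$ with operation $\alpha\star_\sigma\beta=\alpha\sigma\beta$. $P^\sigma=\operatorname{Reg}(\mathcal K_{mn}^\sigma)$ is the subsemigroup of (von Neumann) regular elements of $\mathcal K_{mn}^\sigma$, and $D_r^\sigma=\{\alpha\in P^\sigma:\operatorname{rank}(\alpha)=r\}$. $V(\sigma)=\{\alpha\in\mathcal K_{mn}:\sigma=\sigma\alpha\sigma,\ \alpha=\alpha\sigma\alpha\}$. $\mathbb E(T)$ is the subsemigroup generated by all idempotents of a semigroup $T$. *)

theory Defs
  imports Main "HOL-Library.Disjoint_Sets"
begin

text \<open>
  The vertices x, x' and x''. The doubly primed ones only occur in the middle row of a
  product graph.
\<close>

datatype vertex = Plain nat | Prime nat | DPrime nat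

type_synonym partition = "vertex set set"


section \<open>The partition category and the Brauer category\<close>

definition vertices :: "nat \<Rightarrow> nat \<Rightarrow> vertex set" where
  "vertices m n = Plain ` {1..m} \<union> Prime ` {1..n}"

definition partitions :: "nat \<Rightarrow> nat \<Rightarrow> partition set" where
  "partitions m n = {\<alpha>. partition_on (vertices m n) \<alpha>}"

text \<open>
  A category is represented by the set of all its morphisms.
\<close>

definition partition_category :: "partition set" where
  "partition_category = (\<Union>m n. partitions m n)"

definition brauer_category :: "partition set" where
  "brauer_category = {\<alpha> \<in> partition_category. \<forall>A\<in>\<alpha>. card A = 2}"

definition homset :: "partition set \<Rightarrow> nat \<Rightarrow> nat \<Rightarrow> partition set" where
  "homset K m n = K \<inter> partitions m n"

fun rename_lower :: "vertex \<Rightarrow> vertex" where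
  "rename_lower (Prime x) = DPrime x"
| "rename_lower v = v"

fun rename_upper :: "vertex \<Rightarrow> vertex" where
  "rename_upper (Plain x) = DPrime x"
| "rename_upper v = v"

text \<open>
  Among the graphs whose connected components are the blocks, we choose the one in which any
  two vertices of a block are adjacent; the product does not depend on this choice.
\<close>

definition edges :: "partition \<Rightarrow> vertex rel" where
  "edges \<alpha> = {(x, y). \<exists>A\<in>\<alpha>. x \<in> A \<and> y \<in> A}"

definition product_graph :: "partition \<Rightarrow> partition \<Rightarrow> vertex rel" where
  "product_graph \<alpha> \<beta> =
     edges ((`) rename_lower ` \<alpha>) \<union> edges ((`) rename_upper ` \<beta>)"

text \<open>
  For \<alpha> in \<open>partitions m n\<close> and \<beta> in \<open>partitions n k\<close>, the set below is \<open>vertices m k\<close>. Hence the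
  product needs no index arguments. It is only meaningful for such composable pairs.
\<close>

definition outer_vertices :: "partition \<Rightarrow> partition \<Rightarrow> vertex set" where
  "outer_vertices \<alpha> \<beta> = (\<Union>\<alpha> \<inter> range Plain) \<union> (\<Union>\<beta> \<inter> range Prime)"

definition part_mult :: "partition \<Rightarrow> partition \<Rightarrow> partition"  (infixl "\<cdot>" 70) where
  "\<alpha> \<cdot> \<beta> = outer_vertices \<alpha> \<beta> //
     {(x, y). x \<in> outer_vertices \<alpha> \<beta> \<and> y \<in> outer_vertices \<alpha> \<beta> \<and> (x, y) \<in> (product_graph \<alpha> \<beta>)\<^sup>*}"

definition rank :: "partition \<Rightarrow> nat" where
  "rank \<alpha> = card {A \<in> \<alpha>. A \<inter> range Plain \<noteq> {} \<and> A \<inter> range Prime \<noteq> {}}"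


section \<open>Semigroups given by a carrier set and an operation\<close>

definition Reg :: "'a set \<Rightarrow> ('a \<Rightarrow> 'a \<Rightarrow> 'a) \<Rightarrow> 'a set" where
  "Reg S f = {x \<in> S. \<exists>y\<in>S. x = f (f x y) x}"

definition idempotents :: "'a set \<Rightarrow> ('a \<Rightarrow> 'a \<Rightarrow> 'a) \<Rightarrow> 'a set" where
  "idempotents S f = {x \<in> S. f x x = x}"

inductive_set generated_subsemigroup :: "('a \<Rightarrow> 'a \<Rightarrow> 'a) \<Rightarrow> 'a set \<Rightarrow> 'a set"
  for f :: "'a \<Rightarrow> 'a \<Rightarrow> 'a" and X :: "'a set" where
  generator: "x \<in> X \<Longrightarrow> x \<in> generated_subsemigroup f X"
| closed: "x \<in> generated_subsemigroup f X \<Longrightarrow> y \<in> generated_subsemigroup f X \<Longrightarrow>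
     f x y \<in> generated_subsemigroup f X"

definition idempotent_generated :: "'a set \<Rightarrow> ('a \<Rightarrow> 'a \<Rightarrow> 'a) \<Rightarrow> 'a set" where
  "idempotent_generated S f = generated_subsemigroup f (idempotents S f)"


section \<open>Sandwich semigroups\<close>

text \<open>
  For \<sigma> in \<open>homset K n m\<close>, the sandwich semigroup is the set \<open>homset K m n\<close> with the
  operation \<open>sandwich \<sigma>\<close>.
\<close>

definition sandwich :: "partition \<Rightarrow> partition \<Rightarrow> partition \<Rightarrow> partition" where
  "sandwich \<sigma> \<alpha> \<beta> = \<alpha> \<cdot> \<sigma> \<cdot> \<beta>"

definition P_sandwich :: "partition set \<Rightarrow> nat \<Rightarrow> nat \<Rightarrow> partition \<Rightarrow> partition set" where
  "P_sandwich K m n \<sigma> = Reg (homset K m n) (sandwich \<sigma>)"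

definition D_sandwich :: "partition set \<Rightarrow> nat \<Rightarrow> nat \<Rightarrow> partition \<Rightarrow> nat \<Rightarrow> partition set" where
  "D_sandwich K m n \<sigma> r = {\<alpha> \<in> P_sandwich K m n \<sigma>. rank \<alpha> = r}"

definition V_sandwich :: "partition set \<Rightarrow> nat \<Rightarrow> nat \<Rightarrow> partition \<Rightarrow> partition set" where
  "V_sandwich K m n \<sigma> = {\<alpha> \<in> homset K m n. \<sigma> = \<sigma> \<cdot> \<alpha> \<cdot> \<sigma> \<and> \<alpha> = \<alpha> \<cdot> \<sigma> \<cdot> \<alpha>}"

end

theory Submission
  imports Defs
begin

text \<open>
  Represent a partition \<open>\<alpha>\<close> by the relation \<open>rel \<alpha>\<close> of all pairs \<open>(U, W)\<close> such that \<open>U\<close> in the upper row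
  together with \<open>W\<close> in the lower row is a union of blocks. This is faithful (\<open>rel_inject\<close>) and turns
  the product of partitions into composition of relations (\<open>rel_mult\<close>), so all equations can be
  verified for relations. The involution that reflects a partition becomes the converse.
  
  A morphism of rank \<open>q\<close> factors as \<open>L O M\<inverse>\<close> with \<open>L\<inverse> O L\<close> and \<open>M\<inverse> O M\<close> the identity
  of \<open>q\<close> (\<open>rank_factor\<close>), and it factors through no smaller object (\<open>rank_le\<close>). Write \<open>S = A O B\<inverse>\<close>
  for \<open>S = rel \<sigma>\<close> in this way.
  
  The elements of rank \<open>r\<close>. If \<open>R O S O R = R\<close> and \<open>R\<close> has rank \<open>r\<close>, then, since a one-sided inverse in the
  finite endomorphism monoid of \<open>r\<close> is two-sided, \<open>S O R O S = S\<close> (\<open>top_rank_idempotent\<close>). So the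
  idempotents of rank \<open>r\<close> lie in \<open>V(\<sigma>)\<close>, which is closed under the sandwich product. All regular
  elements have rank at most \<open>r\<close> and form a subsemigroup (\<open>regular_product\<close>), and a product has rank \<open>r\<close>
  only if both factors have. Hence every product of idempotents lies in the right-hand side.
  
  The elements of smaller rank. Conversely, elements of \<open>V(\<sigma>)\<close> are idempotent. Let \<open>R\<close> be regular of
  rank less than \<open>r\<close>. Up to multiplication by an idempotent on either side, \<open>R\<close> is the lift of an
  endomorphism \<open>L O M\<inverse>\<close> of \<open>r\<close> of rank \<open>q < r\<close> (\<open>low_rank_generated\<close>). Call two retracts \<open>L\<close>, \<open>M\<close>
  from \<open>r\<close> to \<open>q\<close> linked if \<open>L\<inverse> O M\<close> is the identity. Then \<open>L O M\<inverse>\<close> is idempotent, and along a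
  path of linked retracts these idempotents multiply to \<open>L O M\<inverse>\<close> for the end points \<open>L\<close>, \<open>M\<close> of the
  path. So it suffices that any two retracts are connected when \<open>q < r\<close> (\<open>retracts_connected\<close>). A
  retract is supported by an injection of \<open>{1..q}\<close> into \<open>{1..r}\<close>. Retracts with the same support are
  connected, one value of the support can be moved to a free place, and such moves connect any two
  injections because \<open>q < r\<close>.
\<close>

section \<open>Partitions as relations between sets of vertices\<close>

text \<open>
  The set of vertices with \<open>U\<close> in the upper row and \<open>W\<close> in the lower row.
\<close>

definition row_set :: "nat set \<Rightarrow> nat set \<Rightarrow> vertex set" where
  "row_set U W = Plain ` U \<union> Prime ` W"

text \<open>
  The pairs \<open>(U, W)\<close> such that \<open>U\<close> in the upper row together with \<open>W\<close> in the lower row is a union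
  of blocks, which is expressed as closure under adjacency. Composition of these relations is
  relational composition, so associativity comes for free.
\<close>

definition rel :: "partition \<Rightarrow> (nat set \<times> nat set) set" where
  "rel \<alpha> = {(U, W). row_set U W \<subseteq> \<Union>\<alpha> \<and> edges \<alpha> `` row_set U W \<subseteq> row_set U W}"

lemma row_set_simps [simp]:
  "Plain x \<in> row_set U W \<longleftrightarrow> x \<in> U"
  "Prime x \<in> row_set U W \<longleftrightarrow> x \<in> W"
  "DPrime x \<notin> row_set U W"
  by (auto simp: row_set_def)

lemma vertices_simps [simp]:
  "Plain x \<in> vertices m n \<longleftrightarrow> x \<in> {1..m}"
  "Prime x \<in> vertices m n \<longleftrightarrow> x \<in> {1..n}"
  "DPrime x \<notin> vertices m n"
  by (auto simp: vertices_def)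

lemma row_set_subset_vertices [simp]:
  "row_set U W \<subseteq> vertices m n \<longleftrightarrow> U \<subseteq> {1..m} \<and> W \<subseteq> {1..n}"
  by (auto simp: row_set_def vertices_def)

lemma finite_vertices [simp]: "finite (vertices m n)"
  by (simp add: vertices_def)

lemma vertices_subset_row_set:
  assumes "Z \<subseteq> vertices m n"
  obtains U W where "Z = row_set U W"
proof
  show "Z = row_set {x. Plain x \<in> Z} {x. Prime x \<in> Z}"
  proof (rule set_eqI)
    fix v show "v \<in> Z \<longleftrightarrow> v \<in> row_set {x. Plain x \<in> Z} {x. Prime x \<in> Z}"
      using assms by (cases v) auto
  qed
qed

lemma partitionsD:
  assumes "\<alpha> \<in> partitions m n"
  shows "\<Union>\<alpha> = vertices m n" "disjoint \<alpha>" "{} \<notin> \<alpha>"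
  using assms by (auto simp: partitions_def partition_on_def)

lemma sym_edges: "sym (edges \<alpha>)"
  by (auto simp: edges_def sym_def)

lemma edges_in_vertices:
  assumes "\<alpha> \<in> partitions m n" "(x, y) \<in> edges \<alpha>"
  shows "x \<in> vertices m n" "y \<in> vertices m n"
  using assms partitionsD(1)[OF assms(1)] by (auto simp: edges_def)

lemma edges_image: "edges ((`) f ` \<alpha>) = map_prod f f ` edges \<alpha>"
  by (fastforce simp: edges_def)

lemma block_eq_edges:
  assumes "\<alpha> \<in> partitions m n" "A \<in> \<alpha>" "x \<in> A"
  shows "A = edges \<alpha> `` {x}"
  using assms partitionsD(2)[OF assms(1)] by (fastforce simp: edges_def disjoint_def)

lemma edges_quotient:
  assumes "equiv A r"
  shows "edges (A // r) = r"
proof (intro set_eqI iffI)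
  fix z assume "z \<in> edges (A // r)"
  then show "z \<in> r"
    using assms by (auto simp: edges_def dest: in_quotient_imp_in_rel)
next
  fix z assume "z \<in> r"
  then obtain x y where z: "z = (x, y)" "(x, y) \<in> r" by (cases z) auto
  then have "x \<in> A" using assms by (auto simp: equiv_def refl_on_def)
  then have "x \<in> r `` {x}" by (rule equiv_class_self[OF assms])
  then show "z \<in> edges (A // r)"
    using z \<open>x \<in> A\<close> by (auto simp: edges_def quotient_def)
qed

lemma outer_vertices_eq:
  assumes "\<alpha> \<in> partitions m n" "\<beta> \<in> partitions n k"
  shows "outer_vertices \<alpha> \<beta> = vertices m k"
  using partitionsD(1)[OF assms(1)] partitionsD(1)[OF assms(2)]
  by (auto simp: outer_vertices_def vertices_def)

lemma sym_product_graph: "sym (product_graph \<alpha> \<beta>)"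
  unfolding product_graph_def by (intro sym_Un sym_edges)

lemma equiv_product_graph:
  "equiv V {(x, y). x \<in> V \<and> y \<in> V \<and> (x, y) \<in> (product_graph \<alpha> \<beta>)\<^sup>*}"
proof (rule equivI)
  show "sym {(x, y). x \<in> V \<and> y \<in> V \<and> (x, y) \<in> (product_graph \<alpha> \<beta>)\<^sup>*}"
    using sym_rtrancl[OF sym_product_graph[of \<alpha> \<beta>]] by (auto simp: sym_def)
qed (auto simp: refl_on_def trans_def)

lemma part_mult_in_partitions:
  assumes "\<alpha> \<in> partitions m n" "\<beta> \<in> partitions n k"
  shows "\<alpha> \<cdot> \<beta> \<in> partitions m k"
  unfolding part_mult_def partitions_def outer_vertices_eq[OF assms]
  using partition_on_quotient[OF equiv_product_graph] by simp

lemma edges_part_mult: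
  assumes "\<alpha> \<in> partitions m n" "\<beta> \<in> partitions n k"
  shows "edges (\<alpha> \<cdot> \<beta>) =
    {(x, y). x \<in> vertices m k \<and> y \<in> vertices m k \<and> (x, y) \<in> (product_graph \<alpha> \<beta>)\<^sup>*}"
  unfolding part_mult_def outer_vertices_eq[OF assms]
  by (rule edges_quotient[OF equiv_product_graph])

lemma product_graph_eq:
  "product_graph \<alpha> \<beta> = map_prod rename_lower rename_lower ` edges \<alpha> \<union>
    map_prod rename_upper rename_upper ` edges \<beta>"
  by (simp add: product_graph_def edges_image)

lemma rel_iff:
  assumes "\<alpha> \<in> partitions m n"
  shows "(U, W) \<in> rel \<alpha> \<longleftrightarrow> U \<subseteq> {1..m} \<and> W \<subseteq> {1..n} \<and>
    (\<forall>x y. (x, y) \<in> edges \<alpha> \<longrightarrow> x \<in> row_set U W \<longrightarrow> y \<in> row_set U W)"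
  using partitionsD(1)[OF assms] by (auto simp: rel_def)

text \<open>
  If \<open>(U, W)\<close> is a union of blocks of the product, the component closure \<open>Z\<close> of its vertices in the
  product graph adds no outer vertices, and the middle vertices in \<open>Z\<close> are the intermediate set.
\<close>

lemma rel_mult:
  assumes \<alpha>: "\<alpha> \<in> partitions m n" and \<beta>: "\<beta> \<in> partitions n k"
  shows "rel (\<alpha> \<cdot> \<beta>) = rel \<alpha> O rel \<beta>"
proof (intro set_eqI iffI)
  let ?G = "product_graph \<alpha> \<beta>"
  fix z assume "z \<in> rel (\<alpha> \<cdot> \<beta>)"
  then obtain U W where z: "z = (U, W)" "(U, W) \<in> rel (\<alpha> \<cdot> \<beta>)" by (cases z) auto
  have U: "U \<subseteq> {1..m}" and W: "W \<subseteq> {1..k}"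
    and cl: "\<And>x y. x \<in> vertices m k \<Longrightarrow> y \<in> vertices m k \<Longrightarrow> (x, y) \<in> ?G\<^sup>* \<Longrightarrow>
      x \<in> row_set U W \<Longrightarrow> y \<in> row_set U W"
    using z(2) unfolding rel_iff[OF part_mult_in_partitions[OF \<alpha> \<beta>]] edges_part_mult[OF \<alpha> \<beta>]
    by blast+
  have UW: "row_set U W \<subseteq> vertices m k" using U W by simp
  define Z where "Z = ?G\<^sup>* `` row_set U W"
  define T where "T = {t. DPrime t \<in> Z}"
  have step: "y \<in> Z" if "x \<in> Z" "(x, y) \<in> ?G" for x y
    using that unfolding Z_def by (auto intro: rtrancl_into_rtrancl)
  have outer: "v \<in> Z \<longleftrightarrow> v \<in> row_set U W" if "v \<in> vertices m k" for v
    using that cl UW unfolding Z_def by blast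
  have T: "T \<subseteq> {1..n}"
  proof
    fix t assume "t \<in> T"
    then obtain x where "x \<in> row_set U W" "(x, DPrime t) \<in> ?G\<^sup>*"
      by (auto simp: T_def Z_def)
    then have "DPrime t \<in> Range ?G"
      by (metis Range.intros rtranclE row_set_simps(3))
    then obtain u v where "(u, v) \<in> edges \<alpha> \<and> DPrime t = rename_lower v \<or>
        (u, v) \<in> edges \<beta> \<and> DPrime t = rename_upper v"
      unfolding product_graph_eq by auto
    then show "t \<in> {1..n}"
    proof
      assume "(u, v) \<in> edges \<alpha> \<and> DPrime t = rename_lower v"
      then show ?thesis using edges_in_vertices[OF \<alpha>, of u v] by (cases v) auto
    next
      assume "(u, v) \<in> edges \<beta> \<and> DPrime t = rename_upper v"
      then show ?thesis using edges_in_vertices[OF \<beta>, of u v] by (cases v) auto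
    qed
  qed
  have low: "rename_lower v \<in> Z \<longleftrightarrow> v \<in> row_set U T" if "v \<in> vertices m n" for v
    using that outer[of v] by (cases v) (auto simp: T_def)
  have up: "rename_upper v \<in> Z \<longleftrightarrow> v \<in> row_set T W" if "v \<in> vertices n k" for v
    using that outer[of v] by (cases v) (auto simp: T_def)
  have "(U, T) \<in> rel \<alpha>"
    unfolding rel_iff[OF \<alpha>]
  proof (intro conjI U T allI impI)
    fix x y assume e: "(x, y) \<in> edges \<alpha>" and x: "x \<in> row_set U T"
    have "(rename_lower x, rename_lower y) \<in> ?G"
      using e by (force simp: product_graph_eq)
    then show "y \<in> row_set U T"
      using step low edges_in_vertices[OF \<alpha> e] x by blast
  qed
  moreover have "(T, W) \<in> rel \<beta>"
    unfolding rel_iff[OF \<beta>]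
  proof (intro conjI W T allI impI)
    fix x y assume e: "(x, y) \<in> edges \<beta>" and x: "x \<in> row_set T W"
    have "(rename_upper x, rename_upper y) \<in> ?G"
      using e by (force simp: product_graph_eq)
    then show "y \<in> row_set T W"
      using step up edges_in_vertices[OF \<beta> e] x by blast
  qed
  ultimately show "z \<in> rel \<alpha> O rel \<beta>" using z by blast
next
  let ?G = "product_graph \<alpha> \<beta>"
  fix z assume "z \<in> rel \<alpha> O rel \<beta>"
  then obtain U T W where z: "z = (U, W)" and UT: "(U, T) \<in> rel \<alpha>" and TW: "(T, W) \<in> rel \<beta>"
    by auto
  define Z where "Z = Plain ` U \<union> DPrime ` T \<union> Prime ` W"
  have low: "rename_lower v \<in> Z \<longleftrightarrow> v \<in> row_set U T" if "v \<in> vertices m n" for v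
    using that by (cases v) (auto simp: Z_def)
  have up: "rename_upper v \<in> Z \<longleftrightarrow> v \<in> row_set T W" if "v \<in> vertices n k" for v
    using that by (cases v) (auto simp: Z_def)
  have step: "y \<in> Z" if "(x, y) \<in> ?G" "x \<in> Z" for x y
    using that(1) unfolding product_graph_eq
  proof
    assume "(x, y) \<in> map_prod rename_lower rename_lower ` edges \<alpha>"
    then obtain u v where uv: "(u, v) \<in> edges \<alpha>" "x = rename_lower u" "y = rename_lower v"
      by auto
    then show ?thesis
      using UT low edges_in_vertices[OF \<alpha> uv(1)] \<open>x \<in> Z\<close> unfolding rel_iff[OF \<alpha>] by blast
  next
    assume "(x, y) \<in> map_prod rename_upper rename_upper ` edges \<beta>"
    then obtain u v where uv: "(u, v) \<in> edges \<beta>" "x = rename_upper u" "y = rename_upper v"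
      by auto
    then show ?thesis
      using TW up edges_in_vertices[OF \<beta> uv(1)] \<open>x \<in> Z\<close> unfolding rel_iff[OF \<beta>] by blast
  qed
  have steps: "y \<in> Z" if "(x, y) \<in> ?G\<^sup>*" "x \<in> Z" for x y
    using that by (induction rule: rtrancl_induct) (auto intro: step)
  have outer: "v \<in> Z \<longleftrightarrow> v \<in> row_set U W" if "v \<in> vertices m k" for v
    using that by (cases v) (auto simp: Z_def)
  show "z \<in> rel (\<alpha> \<cdot> \<beta>)"
    unfolding z rel_iff[OF part_mult_in_partitions[OF \<alpha> \<beta>]] edges_part_mult[OF \<alpha> \<beta>]
    using UT TW steps outer unfolding rel_iff[OF \<alpha>] rel_iff[OF \<beta>] by blast
qed

text \<open>
  A block is the smallest union of blocks that contains a given vertex. Hence the relation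
  determines the partition.
\<close>

lemma edges_from_rel:
  assumes "\<alpha> \<in> partitions m n"
  shows "edges \<alpha> = {(x, y). x \<in> vertices m n \<and>
    (\<forall>U W. (U, W) \<in> rel \<alpha> \<longrightarrow> x \<in> row_set U W \<longrightarrow> y \<in> row_set U W)}"
proof (intro set_eqI iffI)
  fix z assume "z \<in> edges \<alpha>"
  then show "z \<in> {(x, y). x \<in> vertices m n \<and>
    (\<forall>U W. (U, W) \<in> rel \<alpha> \<longrightarrow> x \<in> row_set U W \<longrightarrow> y \<in> row_set U W)}"
    using edges_in_vertices[OF assms] unfolding rel_iff[OF assms] by (cases z) auto
next
  fix z assume z: "z \<in> {(x, y). x \<in> vertices m n \<and>
    (\<forall>U W. (U, W) \<in> rel \<alpha> \<longrightarrow> x \<in> row_set U W \<longrightarrow> y \<in> row_set U W)}"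
  obtain x y where xy: "z = (x, y)" by (cases z)
  have "x \<in> \<Union>\<alpha>" using z xy partitionsD(1)[OF assms] by auto
  then obtain A where A: "A \<in> \<alpha>" "x \<in> A" by blast
  have "A \<subseteq> vertices m n" using A partitionsD(1)[OF assms] by auto
  then obtain U W where UW: "A = row_set U W" by (rule vertices_subset_row_set)
  have "(U, W) \<in> rel \<alpha>"
    unfolding rel_iff[OF assms] UW[symmetric]
    using \<open>A \<subseteq> vertices m n\<close> A(1) UW partitionsD(2)[OF assms]
    by (fastforce simp: edges_def disjoint_def)
  then have "y \<in> A" using z xy A(2) UW by auto
  then show "z \<in> edges \<alpha>" using A xy by (auto simp: edges_def)
qed

lemma partition_from_edges:
  assumes "\<alpha> \<in> partitions m n"
  shows "\<alpha> = {edges \<alpha> `` {x} |x. x \<in> vertices m n}"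
proof (intro set_eqI iffI)
  fix A assume A: "A \<in> \<alpha>"
  then obtain x where "x \<in> A" using partitionsD(3)[OF assms] by (metis ex_in_conv)
  then show "A \<in> {edges \<alpha> `` {x} |x. x \<in> vertices m n}"
    using A block_eq_edges[OF assms] partitionsD(1)[OF assms] by blast
next
  fix A assume "A \<in> {edges \<alpha> `` {x} |x. x \<in> vertices m n}"
  then obtain x where x: "x \<in> vertices m n" "A = edges \<alpha> `` {x}" by blast
  then obtain B where "B \<in> \<alpha>" "x \<in> B" using partitionsD(1)[OF assms] by blast
  then show "A \<in> \<alpha>" using x block_eq_edges[OF assms] by metis
qed

lemma edges_inject:
  assumes "\<alpha> \<in> partitions m n" "\<beta> \<in> partitions m n" "edges \<alpha> = edges \<beta>"
  shows "\<alpha> = \<beta>"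
proof -
  have "\<alpha> = {edges \<alpha> `` {x} |x. x \<in> vertices m n}"
    by (rule partition_from_edges[OF assms(1)])
  also have "\<dots> = {edges \<beta> `` {x} |x. x \<in> vertices m n}"
    by (simp only: assms(3))
  also have "\<dots> = \<beta>"
    by (rule partition_from_edges[OF assms(2), symmetric])
  finally show ?thesis .
qed

lemma rel_inject:
  assumes "\<alpha> \<in> partitions m n" "\<beta> \<in> partitions m n" "rel \<alpha> = rel \<beta>"
  shows "\<alpha> = \<beta>"
proof (rule edges_inject[OF assms(1,2)])
  show "edges \<alpha> = edges \<beta>"
    using assms(3) edges_from_rel[OF assms(1)] edges_from_rel[OF assms(2)] by simp
qed

section \<open>Partitions as colourings\<close>

text \<open>
  A colouring \<open>c\<close> of the vertices induces the relation of pairs of preimages of a set \<open>C\<close> of colours.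
\<close>

definition colour_rel :: "nat \<Rightarrow> nat \<Rightarrow> (vertex \<Rightarrow> 'c) \<Rightarrow> (nat set \<times> nat set) set" where
  "colour_rel m n c =
     {(U, W). \<exists>C. U = {x \<in> {1..m}. c (Plain x) \<in> C} \<and> W = {y \<in> {1..n}. c (Prime y) \<in> C}}"

text \<open>
  The partition of \<open>vertices m n\<close> into colour classes. Only the values of \<open>c\<close> on \<open>vertices m n\<close> matter.
\<close>

definition fibres :: "nat \<Rightarrow> nat \<Rightarrow> (vertex \<Rightarrow> 'c) \<Rightarrow> partition" where
  "fibres m n c = vertices m n // {(v, w). v \<in> vertices m n \<and> w \<in> vertices m n \<and> c v = c w}"

text \<open>
  All colour classes have exactly two elements: every vertex has exactly one partner.
\<close>

definition paired :: "nat \<Rightarrow> nat \<Rightarrow> (vertex \<Rightarrow> 'c) \<Rightarrow> bool" where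
  "paired m n c \<longleftrightarrow> (\<forall>v \<in> vertices m n. \<exists>!w. w \<in> vertices m n \<and> w \<noteq> v \<and> c w = c v)"

lemma equiv_fibres:
  "equiv (vertices m n) {(v, w). v \<in> vertices m n \<and> w \<in> vertices m n \<and> c v = c w}"
  by (rule equivI) (auto simp: refl_on_def sym_def trans_def)

lemma fibres_in_partitions: "fibres m n c \<in> partitions m n"
  unfolding fibres_def partitions_def using partition_on_quotient[OF equiv_fibres] by simp

lemma edges_fibres:
  "edges (fibres m n c) = {(v, w). v \<in> vertices m n \<and> w \<in> vertices m n \<and> c v = c w}"
  unfolding fibres_def by (rule edges_quotient[OF equiv_fibres])

lemma fibres_edges:
  assumes "\<alpha> \<in> partitions m n"
  shows "fibres m n (\<lambda>v. edges \<alpha> `` {v}) = \<alpha>"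
proof -
  have 1: "w \<in> edges \<alpha> `` {v} \<longleftrightarrow> edges \<alpha> `` {v} = edges \<alpha> `` {w}"
    if "v \<in> vertices m n" "w \<in> vertices m n" for v w
  proof -
    obtain A B where "A \<in> \<alpha>" "v \<in> A" "B \<in> \<alpha>" "w \<in> B"
      using \<open>v \<in> _\<close> \<open>w \<in> _\<close> partitionsD(1)[OF assms] by blast
    then show ?thesis using block_eq_edges[OF assms] by metis
  qed
  show ?thesis
  proof (rule edges_inject[OF fibres_in_partitions assms])
    show "edges (fibres m n (\<lambda>v. edges \<alpha> `` {v})) = edges \<alpha>"
      unfolding edges_fibres
    proof (intro set_eqI)
      fix z :: "vertex \<times> vertex"
      obtain v w where z: "z = (v, w)" by (cases z)
      have "v \<in> vertices m n \<and> w \<in> vertices m n \<and> edges \<alpha> `` {v} = edges \<alpha> `` {w} \<longleftrightarrow>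
          (v, w) \<in> edges \<alpha>"
        using 1[of v w, unfolded Image_singleton_iff] edges_in_vertices[OF assms, of v w] by metis
      then show "z \<in> {(v, w). v \<in> vertices m n \<and> w \<in> vertices m n \<and>
          edges \<alpha> `` {v} = edges \<alpha> `` {w}} \<longleftrightarrow> z \<in> edges \<alpha>"
        unfolding z by (simp only: mem_Collect_eq case_prod_conv)
    qed
  qed
qed

lemma rel_fibres: "rel (fibres m n c) = colour_rel m n c"
proof (intro set_eqI iffI)
  fix z assume "z \<in> rel (fibres m n c)"
  then obtain U W where z: "z = (U, W)" "(U, W) \<in> rel (fibres m n c)" by (cases z) auto
  then have U: "U \<subseteq> {1..m}" "W \<subseteq> {1..n}" and
    cl: "\<And>v w. v \<in> vertices m n \<Longrightarrow> w \<in> vertices m n \<Longrightarrow> c v = c w \<Longrightarrow>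
       v \<in> row_set U W \<Longrightarrow> w \<in> row_set U W"
    unfolding rel_iff[OF fibres_in_partitions] edges_fibres by blast+
  have UW: "row_set U W \<subseteq> vertices m n" using U by simp
  have *: "v \<in> row_set U W \<longleftrightarrow> c v \<in> c ` row_set U W" if "v \<in> vertices m n" for v
    using cl that UW by (metis imageE imageI subsetD)
  have "U = {x \<in> {1..m}. c (Plain x) \<in> c ` row_set U W}"
    using U *[of "Plain _"] by auto
  moreover have "W = {y \<in> {1..n}. c (Prime y) \<in> c ` row_set U W}"
    using U *[of "Prime _"] by auto
  ultimately show "z \<in> colour_rel m n c" unfolding z colour_rel_def by blast
next
  fix z assume "z \<in> colour_rel m n c"
  then obtain C where z: "z = ({x \<in> {1..m}. c (Plain x) \<in> C}, {y \<in> {1..n}. c (Prime y) \<in> C})"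
    unfolding colour_rel_def by auto
  have *: "v \<in> row_set {x \<in> {1..m}. c (Plain x) \<in> C} {y \<in> {1..n}. c (Prime y) \<in> C} \<longleftrightarrow> c v \<in> C"
    if "v \<in> vertices m n" for v using that by (cases v) auto
  show "z \<in> rel (fibres m n c)"
    unfolding z rel_iff[OF fibres_in_partitions] edges_fibres using * by auto
qed

lemma fibre_block:
  "A \<in> fibres m n c \<longleftrightarrow> (\<exists>v \<in> vertices m n. A = {w \<in> vertices m n. c w = c v})"
  unfolding fibres_def quotient_def by (auto simp: eq_commute)

lemma fibres_in_partition_category [simp]: "fibres m n c \<in> partition_category"
  using fibres_in_partitions[of m n c] by (auto simp: partition_category_def)

lemma fibres_in_brauer_iff: "fibres m n c \<in> brauer_category \<longleftrightarrow> paired m n c"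
proof -
  have *: "card {w \<in> vertices m n. c w = c v} = 2 \<longleftrightarrow>
      (\<exists>!w. w \<in> vertices m n \<and> w \<noteq> v \<and> c w = c v)" if "v \<in> vertices m n" for v
  proof -
    let ?F = "{w \<in> vertices m n. w \<noteq> v \<and> c w = c v}"
    have "{w \<in> vertices m n. c w = c v} = insert v ?F" using that by auto
    then have "card {w \<in> vertices m n. c w = c v} = Suc (card ?F)" by simp
    then have "card {w \<in> vertices m n. c w = c v} = 2 \<longleftrightarrow> card ?F = 1" by simp
    also have "\<dots> \<longleftrightarrow> (\<exists>!w. w \<in> vertices m n \<and> w \<noteq> v \<and> c w = c v)"
      by (simp add: card_1_singleton_iff Ex1_def set_eq_iff) blast
    finally show ?thesis .
  qed
  have "(\<forall>A\<in>fibres m n c. card A = 2) \<longleftrightarrow>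
      (\<forall>v\<in>vertices m n. card {w \<in> vertices m n. c w = c v} = 2)"
    unfolding Ball_def fibre_block by blast
  also have "\<dots> \<longleftrightarrow> paired m n c"
    unfolding paired_def using * by (intro ball_cong) auto
  finally show ?thesis
    unfolding brauer_category_def by simp
qed

lemma paired_comp_bij:
  assumes g: "bij_betw g (vertices m' n') (vertices m n)" and c: "paired m n c"
  shows "paired m' n' (c \<circ> g)"
  unfolding paired_def
proof
  fix v assume v: "v \<in> vertices m' n'"
  then have "g v \<in> vertices m n" using g by (auto simp: bij_betw_def)
  then obtain w where w: "w \<in> vertices m n" "w \<noteq> g v" "c w = c (g v)"
    and uniq: "\<And>u. u \<in> vertices m n \<Longrightarrow> u \<noteq> g v \<Longrightarrow> c u = c (g v) \<Longrightarrow> u = w"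
    using c unfolding paired_def by metis
  obtain w' where w': "w' \<in> vertices m' n'" "g w' = w"
    using w(1) bij_betw_imp_surj_on[OF g] by (metis imageE)
  show "\<exists>!w. w \<in> vertices m' n' \<and> w \<noteq> v \<and> (c \<circ> g) w = (c \<circ> g) v"
  proof (intro ex1I[of _ w'] conjI)
    fix u assume u: "u \<in> vertices m' n' \<and> u \<noteq> v \<and> (c \<circ> g) u = (c \<circ> g) v"
    then have "g u \<noteq> g v" using g v by (auto simp: bij_betw_def inj_on_def)
    then have "g u = w" using uniq u g by (auto simp: bij_betw_def)
    then show "u = w'" using w' u g by (auto simp: bij_betw_def inj_on_def)
  qed (use w w' in auto)
qed

section \<open>The Brauer category is closed under products\<close>

text \<open>
  A connected graph has at most one vertex more than it has edges. Connectedness is expressed as: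
  every proper subset \<open>C\<close> of \<open>D\<close> containing \<open>x\<close> is left by an edge. The edges are indexed by \<open>E\<close>
  since a pair of vertices can be joined by several edges.
\<close>

lemma connected_card_le:
  fixes ends :: "'e \<Rightarrow> 'v set"
  assumes "finite E" "finite D" "x \<in> D"
    and cross: "\<And>C. C \<subseteq> D \<Longrightarrow> x \<in> C \<Longrightarrow> C \<noteq> D \<Longrightarrow>
      \<exists>e\<in>E. \<exists>u\<in>C. \<exists>v\<in>D - C. ends e = {u, v}"
  shows "card D \<le> card E + 1"
proof -
  have grow: "\<exists>C\<subseteq>D. x \<in> C \<and> card C = Suc k \<and> k \<le> card {e \<in> E. ends e \<subseteq> C}"
    if "Suc k \<le> card D" for k
    using that
  proof (induction k)
    case 0
    show ?case using \<open>x \<in> D\<close> by (intro exI[of _ "{x}"]) auto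
  next
    case (Suc k)
    then obtain C where C: "C \<subseteq> D" "x \<in> C" "card C = Suc k" "k \<le> card {e \<in> E. ends e \<subseteq> C}"
      by auto
    have "C \<noteq> D" using Suc.prems C(3) by auto
    then obtain e u v where e: "e \<in> E" "u \<in> C" "v \<in> D - C" "ends e = {u, v}"
      using cross[OF C(1,2) \<open>C \<noteq> D\<close>] by blast
    have "finite C" using C(1) \<open>finite D\<close> by (rule finite_subset)
    have "insert e {e \<in> E. ends e \<subseteq> C} \<subseteq> {e \<in> E. ends e \<subseteq> insert v C}" using e by auto
    then have "card (insert e {e \<in> E. ends e \<subseteq> C}) \<le> card {e \<in> E. ends e \<subseteq> insert v C}"
      using \<open>finite E\<close> by (intro card_mono) auto
    moreover have "card (insert e {e \<in> E. ends e \<subseteq> C}) = Suc (card {e \<in> E. ends e \<subseteq> C})"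
      using e \<open>finite E\<close> by simp
    moreover have "card (insert v C) = Suc (Suc k)" using e C \<open>finite C\<close> by simp
    ultimately show ?case
      using C e by (intro exI[of _ "insert v C"]) auto
  qed
  have "card D > 0" using \<open>finite D\<close> \<open>x \<in> D\<close> by (auto simp: card_gt_0_iff)
  then obtain C where "card D - 1 \<le> card {e \<in> E. ends e \<subseteq> C}" using grow[of "card D - 1"] by auto
  also have "\<dots> \<le> card E" using \<open>finite E\<close> by (intro card_mono) auto
  finally show ?thesis by simp
qed

lemma inj_on_rename_lower: "inj_on rename_lower (vertices m n)"
proof (rule inj_onI)
  fix x y assume "x \<in> vertices m n" "y \<in> vertices m n" "rename_lower x = rename_lower y"
  then show "x = y" by (cases x; cases y) auto
qed

lemma inj_on_rename_upper: "inj_on rename_upper (vertices m n)"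
proof (rule inj_onI)
  fix x y assume "x \<in> vertices m n" "y \<in> vertices m n" "rename_upper x = rename_upper y"
  then show "x = y" by (cases x; cases y) auto
qed

text \<open>
  In a union \<open>D\<close> of components, the renamed blocks of a partition into pairs cover exactly the
  renamed vertices, two at a time.
\<close>

lemma card_pairs_in_closed:
  assumes \<alpha>: "\<alpha> \<in> partitions m n" and two: "\<forall>A\<in>\<alpha>. card A = 2"
    and f: "inj_on f (vertices m n)" and "finite D"
    and closed: "\<And>A. A \<in> (`) f ` \<alpha> \<Longrightarrow> A \<inter> D \<noteq> {} \<Longrightarrow> A \<subseteq> D"
  shows "finite {A \<in> (`) f ` \<alpha>. A \<subseteq> D}"
    and "2 * card {A \<in> (`) f ` \<alpha>. A \<subseteq> D} = card (D \<inter> f ` vertices m n)"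
proof -
  show fin: "finite {A \<in> (`) f ` \<alpha>. A \<subseteq> D}"
    by (rule finite_subset[of _ "Pow D"]) (use \<open>finite D\<close> in auto)
  have V: "\<Union>\<alpha> = vertices m n" by (rule partitionsD(1)[OF \<alpha>])
  have card2: "card A = 2" if "A \<in> (`) f ` \<alpha>" for A
  proof -
    obtain B where B: "B \<in> \<alpha>" "A = f ` B" using \<open>A \<in> (`) f ` \<alpha>\<close> by blast
    have "inj_on f B" by (rule inj_on_subset[OF f]) (use B V in auto)
    then show ?thesis using B two by (simp add: card_image)
  qed
  have Un: "\<Union>{A \<in> (`) f ` \<alpha>. A \<subseteq> D} = D \<inter> f ` vertices m n"
  proof (intro set_eqI iffI)
    fix v assume v: "v \<in> D \<inter> f ` vertices m n"
    then obtain B where B: "B \<in> \<alpha>" "v \<in> f ` B" using V by blast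
    then have "f ` B \<subseteq> D" using closed[of "f ` B"] v by blast
    then show "v \<in> \<Union>{A \<in> (`) f ` \<alpha>. A \<subseteq> D}" using B by blast
  qed (use V in blast)
  have "2 * card {A \<in> (`) f ` \<alpha>. A \<subseteq> D} = card (\<Union>{A \<in> (`) f ` \<alpha>. A \<subseteq> D})"
  proof (rule card_partition)
    show "finite (\<Union>{A \<in> (`) f ` \<alpha>. A \<subseteq> D})" unfolding Un using \<open>finite D\<close> by simp
    show "A \<inter> B = {}"
      if "A \<in> {A \<in> (`) f ` \<alpha>. A \<subseteq> D}" "B \<in> {A \<in> (`) f ` \<alpha>. A \<subseteq> D}" "A \<noteq> B" for A B
    proof -
      obtain A' B' where AB: "A' \<in> \<alpha>" "A = f ` A'" "B' \<in> \<alpha>" "B = f ` B'"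
        using \<open>A \<in> _\<close> \<open>B \<in> _\<close> by blast
      have "A' \<inter> B' = {}"
        using partitionsD(2)[OF \<alpha>] AB \<open>A \<noteq> B\<close> unfolding disjoint_def by blast
      moreover have "f ` A' \<inter> f ` B' = f ` (A' \<inter> B')"
        using inj_on_image_Int[OF f, of A' B'] AB V by blast
      ultimately show ?thesis using AB by simp
    qed
  qed (use fin card2 in auto)
  then show "2 * card {A \<in> (`) f ` \<alpha>. A \<subseteq> D} = card (D \<inter> f ` vertices m n)"
    unfolding Un .
qed

lemma rename_lower_vertices: "rename_lower ` vertices m n = Plain ` {1..m} \<union> DPrime ` {1..n}"
  by (simp add: vertices_def image_Un image_image)

lemma rename_upper_vertices: "rename_upper ` vertices m n = DPrime ` {1..m} \<union> Prime ` {1..n}"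
  by (simp add: vertices_def image_Un image_image)

text \<open>
  A component with \<open>p\<close> upper, \<open>d\<close> middle and \<open>s\<close> lower vertices, \<open>a\<close> edges in the upper graph and
  \<open>b\<close> edges in the lower one: the number \<open>p + s\<close> of outer vertices is even, and the bound for
  connected graphs makes it at most two.
\<close>

lemma card_outer_eq_two:
  fixes p d s a b :: nat
  assumes "2 * a = p + d" "2 * b = d + s" "p + d + s \<le> a + b + 1" "p + s \<noteq> 0"
  shows "p + s = 2"
proof -
  have "(p + s) + 2 * d = (p + d) + (d + s)" by simp
  also have "\<dots> = 2 * (a + b)" unfolding assms(1,2)[symmetric] by simp
  finally have "(p + s) + 2 * d = 2 * (a + b)" .
  then have "even (p + s)" by (metis dvd_triv_left even_add)
  then have "p + s \<noteq> 1" by (metis odd_one)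
  moreover have "p + s \<le> 2" using assms(1-3) by linarith
  ultimately show ?thesis using assms(4) by linarith
qed

lemma brauer_mult:
  assumes \<alpha>: "\<alpha> \<in> homset brauer_category m n" and \<beta>: "\<beta> \<in> homset brauer_category n k"
  shows "\<alpha> \<cdot> \<beta> \<in> brauer_category"
proof -
  have \<alpha>P: "\<alpha> \<in> partitions m n" and \<alpha>2: "\<forall>A\<in>\<alpha>. card A = 2"
    and \<beta>P: "\<beta> \<in> partitions n k" and \<beta>2: "\<forall>A\<in>\<beta>. card A = 2"
    using \<alpha> \<beta> by (auto simp: homset_def brauer_category_def)
  let ?G = "product_graph \<alpha> \<beta>"
  let ?\<alpha> = "(`) rename_lower ` \<alpha>" and ?\<beta> = "(`) rename_upper ` \<beta>"
  have P: "\<alpha> \<cdot> \<beta> \<in> partitions m k" by (rule part_mult_in_partitions[OF \<alpha>P \<beta>P])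
  have inL: "inj_on rename_lower A" if "A \<in> \<alpha>" for A
    using inj_on_subset[OF inj_on_rename_lower] partitionsD(1)[OF \<alpha>P] that by blast
  have inU: "inj_on rename_upper A" if "A \<in> \<beta>" for A
    using inj_on_subset[OF inj_on_rename_upper] partitionsD(1)[OF \<beta>P] that by blast
  have pair: "A = {u, v}" if "card A = 2" "u \<in> A" "v \<in> A" "u \<noteq> v" for A and u v :: vertex
    using that by (auto simp: card_2_iff)
  have "card B = 2" if B: "B \<in> \<alpha> \<cdot> \<beta>" for B
  proof -
    obtain x where x: "x \<in> B" using B partitionsD(3)[OF P] by (metis ex_in_conv)
    then have xV: "x \<in> vertices m k" using B partitionsD(1)[OF P] by blast
    define D where "D = ?G\<^sup>* `` {x}"
    have BD: "B = D \<inter> vertices m k"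
      using block_eq_edges[OF P B x] xV unfolding edges_part_mult[OF \<alpha>P \<beta>P] D_def by auto
    let ?T = "Plain ` {1..m}" and ?M = "DPrime ` {1..n}" and ?L = "Prime ` {1..k}"
    have G_ran: "v \<in> ?T \<union> ?M \<union> ?L" if "(u, v) \<in> ?G" for u v
    proof -
      have "v \<in> rename_lower ` vertices m n \<union> rename_upper ` vertices n k"
        using that edges_in_vertices[OF \<alpha>P] edges_in_vertices[OF \<beta>P]
        unfolding product_graph_eq by auto
      then show ?thesis unfolding rename_lower_vertices rename_upper_vertices by blast
    qed
    have DV: "D \<subseteq> ?T \<union> ?M \<union> ?L"
    proof
      fix v assume "v \<in> D"
      then have "(x, v) \<in> ?G\<^sup>*" by (simp add: D_def)
      then show "v \<in> ?T \<union> ?M \<union> ?L"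
        using xV G_ran by (cases rule: rtranclE) (auto simp: vertices_def)
    qed
    then have finD: "finite D" by (rule finite_subset) simp
    have step: "v \<in> D" if "u \<in> D" "(u, v) \<in> ?G" for u v
      using that by (auto simp: D_def intro: rtrancl_into_rtrancl)
    have clA: "A \<subseteq> D" if A: "A \<in> ?\<alpha>" "A \<inter> D \<noteq> {}" for A
    proof
      fix v assume "v \<in> A"
      obtain u where "u \<in> A" "u \<in> D" using A(2) by blast
      have "(u, v) \<in> edges ?\<alpha>" using A(1) \<open>u \<in> A\<close> \<open>v \<in> A\<close> unfolding edges_def by blast
      then show "v \<in> D" using step[OF \<open>u \<in> D\<close>] unfolding product_graph_def by blast
    qed
    have clB: "A \<subseteq> D" if A: "A \<in> ?\<beta>" "A \<inter> D \<noteq> {}" for A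
    proof
      fix v assume "v \<in> A"
      obtain u where "u \<in> A" "u \<in> D" using A(2) by blast
      have "(u, v) \<in> edges ?\<beta>" using A(1) \<open>u \<in> A\<close> \<open>v \<in> A\<close> unfolding edges_def by blast
      then show "v \<in> D" using step[OF \<open>u \<in> D\<close>] unfolding product_graph_def by blast
    qed
    let ?A = "{A \<in> ?\<alpha>. A \<subseteq> D}" and ?B = "{A \<in> ?\<beta>. A \<subseteq> D}"
    have cA: "finite ?A" "2 * card ?A = card (D \<inter> rename_lower ` vertices m n)"
      by (rule card_pairs_in_closed[OF \<alpha>P \<alpha>2 inj_on_rename_lower finD]; fact clA)+
    have cB: "finite ?B" "2 * card ?B = card (D \<inter> rename_upper ` vertices n k)"
      by (rule card_pairs_in_closed[OF \<beta>P \<beta>2 inj_on_rename_upper finD]; fact clB)+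
    have cards: "card D = card (D \<inter> ?T) + card (D \<inter> ?M) + card (D \<inter> ?L)"
      "card B = card (D \<inter> ?T) + card (D \<inter> ?L)"
      "2 * card ?A = card (D \<inter> ?T) + card (D \<inter> ?M)"
      "2 * card ?B = card (D \<inter> ?M) + card (D \<inter> ?L)"
    proof -
      have "D = (D \<inter> ?T) \<union> (D \<inter> ?M) \<union> (D \<inter> ?L)" using DV by blast
      moreover have "card ((D \<inter> ?T) \<union> (D \<inter> ?M) \<union> (D \<inter> ?L)) =
          card (D \<inter> ?T) + card (D \<inter> ?M) + card (D \<inter> ?L)"
        using finD by (subst card_Un_disjoint; auto)+
      ultimately show "card D = card (D \<inter> ?T) + card (D \<inter> ?M) + card (D \<inter> ?L)" by simp
      have "B = (D \<inter> ?T) \<union> (D \<inter> ?L)" unfolding BD vertices_def by blast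
      then show "card B = card (D \<inter> ?T) + card (D \<inter> ?L)"
        using finD by (simp only:) (subst card_Un_disjoint; auto)
      have "D \<inter> rename_lower ` vertices m n = (D \<inter> ?T) \<union> (D \<inter> ?M)"
        unfolding rename_lower_vertices by blast
      then show "2 * card ?A = card (D \<inter> ?T) + card (D \<inter> ?M)"
        using finD unfolding cA(2) by (simp only:) (subst card_Un_disjoint; auto)
      have "D \<inter> rename_upper ` vertices n k = (D \<inter> ?M) \<union> (D \<inter> ?L)"
        unfolding rename_upper_vertices by blast
      then show "2 * card ?B = card (D \<inter> ?M) + card (D \<inter> ?L)"
        using finD unfolding cB(2) by (simp only:) (subst card_Un_disjoint; auto)
    qed
    have "card D \<le> card (?A <+> ?B) + 1"
    proof (rule connected_card_le[where ends = "case_sum id id" and x = x])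
      show "finite (?A <+> ?B)" using cA(1) cB(1) by simp
      show "finite D" "x \<in> D" using finD by (auto simp: D_def)
      fix C assume C: "C \<subseteq> D" "x \<in> C" "C \<noteq> D"
      have "\<exists>u v. (u, v) \<in> ?G \<and> u \<in> C \<and> v \<notin> C"
      proof (rule ccontr)
        assume *: "\<nexists>u v. (u, v) \<in> ?G \<and> u \<in> C \<and> v \<notin> C"
        have "v \<in> C" if "(x, v) \<in> ?G\<^sup>*" for v
          using that by (induction rule: rtrancl_induct) (use C * in auto)
        then have "D \<subseteq> C" by (auto simp: D_def)
        then show False using C by blast
      qed
      then obtain u v where uv: "(u, v) \<in> ?G" "u \<in> C" "v \<notin> C" by blast
      then have "v \<in> D" "u \<in> D" using step C by blast+
      from uv(1) have "(\<exists>A \<in> ?\<alpha>. u \<in> A \<and> v \<in> A) \<or> (\<exists>A \<in> ?\<beta>. u \<in> A \<and> v \<in> A)"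
        unfolding product_graph_def edges_def Un_iff mem_Collect_eq case_prod_conv .
      then have "(\<exists>A \<in> ?A. A = {u, v}) \<or> (\<exists>A \<in> ?B. A = {u, v})"
      proof (elim disjE bexE conjE)
        fix A assume A: "A \<in> ?\<alpha>" "u \<in> A" "v \<in> A"
        then have "card A = 2" using \<alpha>2 inL by (auto simp: card_image)
        moreover have "u \<noteq> v" using uv by blast
        ultimately have "A = {u, v}" using pair A by blast
        then show ?thesis using A \<open>u \<in> D\<close> \<open>v \<in> D\<close> by blast
      next
        fix A assume A: "A \<in> ?\<beta>" "u \<in> A" "v \<in> A"
        then have "card A = 2" using \<beta>2 inU by (auto simp: card_image)
        moreover have "u \<noteq> v" using uv by blast
        ultimately have "A = {u, v}" using pair A by blast
        then show ?thesis using A \<open>u \<in> D\<close> \<open>v \<in> D\<close> by blast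
      qed
      then have "\<exists>e\<in>?A <+> ?B. case_sum id id e = {u, v}"
        by (metis (no_types, lifting) InlI InrI id_apply sum.case)
      then show "\<exists>e\<in>?A <+> ?B. \<exists>u\<in>C. \<exists>v\<in>D - C. case_sum id id e = {u, v}"
        using uv \<open>v \<in> D\<close> by blast
    qed
    then have "card D \<le> card ?A + card ?B + 1" using cA(1) cB(1) by (simp add: card_Plus)
    moreover have "card B \<noteq> 0" using x finD unfolding BD by auto
    ultimately show "card B = 2"
      using card_outer_eq_two[OF cards(3,4)] unfolding cards(1,2) by blast
  qed
  then show ?thesis using P by (auto simp: brauer_category_def partition_category_def)
qed

section \<open>The category of relations\<close>

definition diagram_category :: "partition set \<Rightarrow> bool" where
  "diagram_category K \<longleftrightarrow> K = partition_category \<or> K = brauer_category"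

text \<open>
  The relations that represent the morphisms from \<open>m\<close> to \<open>n\<close>.
\<close>

definition hom_rels :: "partition set \<Rightarrow> nat \<Rightarrow> nat \<Rightarrow> (nat set \<times> nat set) set set" where
  "hom_rels K m n = rel ` homset K m n"

abbreviation unit_rel :: "nat \<Rightarrow> (nat set \<times> nat set) set" where
  "unit_rel n \<equiv> Id_on (Pow {1..n})"

lemma hom_rels_iff:
  "R \<in> hom_rels K m n \<longleftrightarrow>
    (\<exists>c :: vertex \<Rightarrow> vertex set. fibres m n c \<in> K \<and> R = colour_rel m n c)"
proof
  assume "R \<in> hom_rels K m n"
  then obtain \<alpha> where \<alpha>: "\<alpha> \<in> K" "\<alpha> \<in> partitions m n" "R = rel \<alpha>"
    by (auto simp: hom_rels_def homset_def)
  then have "fibres m n (\<lambda>v. edges \<alpha> `` {v}) \<in> K \<and> R = colour_rel m n (\<lambda>v. edges \<alpha> `` {v})"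
    using rel_fibres[of m n "\<lambda>v. edges \<alpha> `` {v}"] by (simp add: fibres_edges)
  then show "\<exists>c :: vertex \<Rightarrow> vertex set. fibres m n c \<in> K \<and> R = colour_rel m n c" by blast
next
  assume "\<exists>c :: vertex \<Rightarrow> vertex set. fibres m n c \<in> K \<and> R = colour_rel m n c"
  then obtain c :: "vertex \<Rightarrow> vertex set" where c: "fibres m n c \<in> K" "R = colour_rel m n c"
    by blast
  then show "R \<in> hom_rels K m n"
    unfolding hom_rels_def homset_def
    using fibres_in_partitions[of m n c] rel_fibres[of m n c] by blast
qed

lemma colour_rel_in_hom_rels:
  assumes "fibres m n c \<in> K"
  shows "colour_rel m n c \<in> hom_rels K m n"
  unfolding hom_rels_def homset_def
  using assms fibres_in_partitions[of m n c] rel_fibres[of m n c] by blast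

lemma fibres_in_categoryI:
  assumes "diagram_category K" "K = brauer_category \<Longrightarrow> paired m n c"
  shows "fibres m n c \<in> K"
  using assms fibres_in_brauer_iff[of m n c] by (auto simp: diagram_category_def)

lemma fibres_comp_bij:
  assumes "diagram_category K" "fibres m n c \<in> K" "bij_betw g (vertices m' n') (vertices m n)"
  shows "fibres m' n' (c \<circ> g) \<in> K"
  using assms(1)
proof (rule fibres_in_categoryI)
  assume "K = brauer_category"
  then show "paired m' n' (c \<circ> g)"
    using paired_comp_bij[OF assms(3)] assms(2) fibres_in_brauer_iff by blast
qed

lemma colour_rel_subset: "colour_rel m n c \<subseteq> Pow {1..m} \<times> Pow {1..n}"
  by (auto simp: colour_rel_def)

lemma hom_rels_subset:
  assumes "R \<in> hom_rels K m n"
  shows "R \<subseteq> Pow {1..m} \<times> Pow {1..n}"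
  using assms colour_rel_subset unfolding hom_rels_iff by blast

lemma unit_rel_right:
  assumes "R \<in> hom_rels K m n"
  shows "R O unit_rel n = R"
  using hom_rels_subset[OF assms] by blast+

lemma unit_rel_left:
  assumes "R \<in> hom_rels K m n"
  shows "unit_rel m O R = R"
  using hom_rels_subset[OF assms] by blast+

lemma part_mult_in_homset:
  assumes "diagram_category K" "\<alpha> \<in> homset K m n" "\<beta> \<in> homset K n k"
  shows "\<alpha> \<cdot> \<beta> \<in> homset K m k"
  using assms part_mult_in_partitions[of \<alpha> m n \<beta> k] brauer_mult[of \<alpha> m n \<beta> k]
  unfolding homset_def diagram_category_def partition_category_def by blast

lemma rel_mult_homset:
  assumes "\<alpha> \<in> homset K m n" "\<beta> \<in> homset K n k"
  shows "rel (\<alpha> \<cdot> \<beta>) = rel \<alpha> O rel \<beta>"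
  using assms rel_mult unfolding homset_def by blast

lemma hom_rels_comp:
  assumes "diagram_category K" "R \<in> hom_rels K m n" "S \<in> hom_rels K n k"
  shows "R O S \<in> hom_rels K m k"
proof -
  obtain \<alpha> \<beta> where "\<alpha> \<in> homset K m n" "\<beta> \<in> homset K n k" "R = rel \<alpha>" "S = rel \<beta>"
    using assms by (auto simp: hom_rels_def)
  then show ?thesis
    unfolding hom_rels_def
    using part_mult_in_homset[OF assms(1)] rel_mult_homset by (metis image_eqI)
qed

text \<open>
  Reflection, which exchanges the two rows; on relations it is the converse.
\<close>

fun swap_rows :: "vertex \<Rightarrow> vertex" where
  "swap_rows (Plain x) = Prime x"
| "swap_rows (Prime x) = Plain x"
| "swap_rows (DPrime x) = DPrime x"

lemma swap_rows_swap_rows [simp]: "swap_rows (swap_rows v) = v"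
  by (cases v) auto

lemma swap_rows_vertices [simp]: "swap_rows v \<in> vertices n m \<longleftrightarrow> v \<in> vertices m n"
  by (cases v) auto

lemma bij_swap_rows: "bij_betw swap_rows (vertices m n) (vertices n m)"
  by (rule bij_betw_byWitness[where f' = swap_rows]) auto

lemma colour_rel_swap: "colour_rel n m (c \<circ> swap_rows) = (colour_rel m n c)\<inverse>"
  unfolding colour_rel_def by auto

lemma hom_rels_converse:
  assumes "diagram_category K" "R \<in> hom_rels K m n"
  shows "R\<inverse> \<in> hom_rels K n m"
proof -
  obtain c :: "vertex \<Rightarrow> vertex set" where c: "fibres m n c \<in> K" "R = colour_rel m n c"
    using assms(2) unfolding hom_rels_iff by blast
  show ?thesis
    unfolding c(2) colour_rel_swap[symmetric]
    by (intro colour_rel_in_hom_rels fibres_comp_bij[OF assms(1) c(1)] bij_swap_rows)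
qed

text \<open>
  The colouring with classes \<open>{Plain x, Prime x}\<close>, which gives the identity partition.
\<close>

fun index :: "vertex \<Rightarrow> nat" where
  "index (Plain x) = x" | "index (Prime x) = x" | "index (DPrime x) = x"

lemma paired_index: "paired n n index"
  unfolding paired_def
proof
  fix v assume v: "v \<in> vertices n n"
  show "\<exists>!w. w \<in> vertices n n \<and> w \<noteq> v \<and> index w = index v"
  proof (intro ex1I[of _ "swap_rows v"])
    fix w assume "w \<in> vertices n n \<and> w \<noteq> v \<and> index w = index v"
    then show "w = swap_rows v" using v by (cases v; cases w) auto
  qed (use v in \<open>cases v; auto\<close>)
qed

lemma unit_rel_in_hom_rels:
  assumes "diagram_category K"
  shows "unit_rel n \<in> hom_rels K n n"
proof -
  have "unit_rel n = colour_rel n n index"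
  proof (intro set_eqI iffI)
    fix z assume "z \<in> unit_rel n"
    then obtain U where U: "z = (U, U)" "U \<subseteq> {1..n}" by blast
    then have "U = {x \<in> {1..n}. x \<in> U}" by blast
    then show "z \<in> colour_rel n n index" unfolding U colour_rel_def by auto
  qed (auto simp: colour_rel_def)
  then show ?thesis
    using colour_rel_in_hom_rels[OF fibres_in_categoryI[OF assms paired_index]] by simp
qed

lemma pairedD:
  assumes "paired m n c" "v \<in> vertices m n"
  obtains w where "w \<in> vertices m n" "w \<noteq> v" "c w = c v"
    "\<And>u. u \<in> vertices m n \<Longrightarrow> u \<noteq> v \<Longrightarrow> c u = c v \<Longrightarrow> u = w"
  using assms unfolding paired_def by (metis (no_types, lifting))

lemma paired_unique:
  assumes "paired m n c" "v \<in> vertices m n"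
    and "u \<in> vertices m n" "u \<noteq> v" "c u = c v" "w \<in> vertices m n" "w \<noteq> v" "c w = c v"
  shows "u = w"
  using assms unfolding paired_def by blast

section \<open>Factorization through the rank\<close>

text \<open>
  Given a colouring \<open>c\<close> and an enumeration \<open>t\<close> of its colours that occur in both rows, recolour the
  lower row by \<open>t\<close>. This is the partition that sends the upper part of the \<open>i\<close>-th transversal to \<open>i\<close>
  and keeps the other upper blocks.
\<close>

definition upper_half :: "(vertex \<Rightarrow> 'c) \<Rightarrow> (nat \<Rightarrow> 'c) \<Rightarrow> vertex \<Rightarrow> 'c" where
  "upper_half c t v = (case v of Prime i \<Rightarrow> t i | _ \<Rightarrow> c v)"

lemma upper_half_simps [simp]:
  "upper_half c t (Plain x) = c (Plain x)" "upper_half c t (Prime i) = t i"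
  by (simp_all add: upper_half_def)

lemma upper_half_retract:
  assumes "t ` {1..q} \<subseteq> c ` Plain ` {1..m}" and "inj_on t {1..q}"
  shows "(colour_rel m q (upper_half c t))\<inverse> O colour_rel m q (upper_half c t) = unit_rel q"
proof (intro set_eqI iffI)
  fix z assume "z \<in> (colour_rel m q (upper_half c t))\<inverse> O colour_rel m q (upper_half c t)"
  then obtain C C' where z: "z = ({i \<in> {1..q}. t i \<in> C}, {i \<in> {1..q}. t i \<in> C'})"
    and eq: "{x \<in> {1..m}. c (Plain x) \<in> C} = {x \<in> {1..m}. c (Plain x) \<in> C'}"
    unfolding colour_rel_def by auto
  have "t i \<in> C \<longleftrightarrow> t i \<in> C'" if i: "i \<in> {1..q}" for i
  proof -
    obtain x where "x \<in> {1..m}" "t i = c (Plain x)" using assms(1) i by blast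
    then show ?thesis using eq by auto
  qed
  then have "{i \<in> {1..q}. t i \<in> C} = {i \<in> {1..q}. t i \<in> C'}" by blast
  then show "z \<in> unit_rel q" unfolding z by (simp only:) (rule Id_onI, blast)
next
  fix z assume "z \<in> unit_rel q"
  then obtain S where z: "z = (S, S)" "S \<subseteq> {1..q}" by blast
  have "S = {i \<in> {1..q}. t i \<in> t ` S}"
    using z(2) inj_on_image_mem_iff[OF assms(2) _ z(2)] by blast
  then have "({x \<in> {1..m}. c (Plain x) \<in> t ` S}, S) \<in> colour_rel m q (upper_half c t)"
    unfolding colour_rel_def by auto
  then show "z \<in> (colour_rel m q (upper_half c t))\<inverse> O colour_rel m q (upper_half c t)"
    unfolding z by blast
qed

lemma upper_half_factor:
  assumes "t ` {1..q} = c ` Plain ` {1..m} \<inter> c ` Prime ` {1..n}"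
  shows "colour_rel m q (upper_half c t) O (colour_rel n q (upper_half (c \<circ> swap_rows) t))\<inverse> =
    colour_rel m n c"
proof (intro set_eqI iffI)
  fix z assume "z \<in> colour_rel m q (upper_half c t) O
    (colour_rel n q (upper_half (c \<circ> swap_rows) t))\<inverse>"
  then obtain C C' where z: "z = ({x \<in> {1..m}. c (Plain x) \<in> C}, {y \<in> {1..n}. c (Prime y) \<in> C'})"
    and eq: "{i \<in> {1..q}. t i \<in> C} = {i \<in> {1..q}. t i \<in> C'}"
    unfolding colour_rel_def by auto
  have trans: "c (Plain x) \<in> C \<longleftrightarrow> c (Plain x) \<in> C'"
    if xy: "x \<in> {1..m}" "y \<in> {1..n}" "c (Plain x) = c (Prime y)" for x y
  proof -
    have "c (Plain x) \<in> t ` {1..q}" using assms xy by blast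
    then show ?thesis using eq by auto
  qed
  \<comment> \<open>The two colour sets agree on the colours that occur in both rows.\<close>
  define D where "D = (C \<inter> c ` Plain ` {1..m}) \<union> (C' \<inter> c ` Prime ` {1..n})"
  have "{x \<in> {1..m}. c (Plain x) \<in> C} = {x \<in> {1..m}. c (Plain x) \<in> D}"
    unfolding D_def using trans by auto
  moreover have "{y \<in> {1..n}. c (Prime y) \<in> C'} = {y \<in> {1..n}. c (Prime y) \<in> D}"
    unfolding D_def using trans by (auto, metis atLeastAtMost_iff)
  ultimately show "z \<in> colour_rel m n c" unfolding z colour_rel_def by blast
qed (auto simp: colour_rel_def)

lemma paired_upper_half:
  assumes c: "paired m n c" and inj: "inj_on t {1..q}"
    and t: "t ` {1..q} = c ` Plain ` {1..m} \<inter> c ` Prime ` {1..n}"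
  shows "paired m q (upper_half c t)"
  unfolding paired_def
proof
  fix v assume v: "v \<in> vertices m q"
  show "\<exists>!w. w \<in> vertices m q \<and> w \<noteq> v \<and> upper_half c t w = upper_half c t v"
  proof (cases v)
    case (Plain x)
    then have x: "Plain x \<in> vertices m n" using v by simp
    obtain w where w: "w \<in> vertices m n" "w \<noteq> Plain x" "c w = c (Plain x)"
      and uniq: "\<And>u. u \<in> vertices m n \<Longrightarrow> u \<noteq> Plain x \<Longrightarrow> c u = c (Plain x) \<Longrightarrow> u = w"
      using pairedD[OF c x] by blast
    show ?thesis
    proof (cases w)
      case w': (Plain x')
      have "t i \<noteq> c (Plain x)" if i: "i \<in> {1..q}" for i
      proof
        assume "t i = c (Plain x)"
        moreover obtain y where "y \<in> {1..n}" "t i = c (Prime y)" using t i by blast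
        ultimately have "Prime y = w" using uniq[of "Prime y"] by simp
        then show False using w' by simp
      qed
      then have "u = w" if "u \<in> vertices m q \<and> u \<noteq> v \<and> upper_half c t u = upper_half c t v" for u
        using that uniq[of u] Plain by (cases u) auto
      then show ?thesis using w w' Plain by (intro ex1I[of _ w]) auto
    next
      case w': (Prime y)
      have "x \<in> {1..m}" "y \<in> {1..n}" "c (Plain x) = c (Prime y)" using x w w' by auto
      then have "c (Plain x) \<in> t ` {1..q}" unfolding t by (metis IntI imageI)
      then obtain i where i: "i \<in> {1..q}" "t i = c (Plain x)" by auto
      have "u = Prime i" if "u \<in> vertices m q \<and> u \<noteq> v \<and> upper_half c t u = upper_half c t v" for u
      proof (cases u)
        case (Plain x')
        then show ?thesis using that uniq[of u] \<open>v = Plain x\<close> w' by simp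
      next
        case (Prime j)
        then have "t j = t i" "j \<in> {1..q}" using that \<open>v = Plain x\<close> i by auto
        then show ?thesis using inj_onD[OF inj] i Prime by blast
      qed (use that in simp)
      then show ?thesis using i Plain by (intro ex1I[of _ "Prime i"]) auto
    qed (use w in simp)
  next
    case (Prime i)
    then have i: "i \<in> {1..q}" using v by simp
    then obtain x y where x: "x \<in> {1..m}" "t i = c (Plain x)" and y: "y \<in> {1..n}" "t i = c (Prime y)"
      using t by blast
    have "u = Plain x" if u: "u \<in> vertices m q \<and> u \<noteq> v \<and> upper_half c t u = upper_half c t v" for u
    proof (cases u)
      case u': (Plain x')
      have "Plain x' = Plain x"
      proof (rule paired_unique[OF c, of "Prime y"])
        show "c (Plain x') = c (Prime y)" "Plain x' \<in> vertices m n" using u u' Prime y by auto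
        show "c (Plain x) = c (Prime y)" "Plain x \<in> vertices m n" using x y by auto
      qed (use y in simp_all)
      then show ?thesis using u' by simp
    next
      case u': (Prime j)
      then have "t j = t i" "j \<in> {1..q}" using u Prime by auto
      then show ?thesis using inj_onD[OF inj] i u u' Prime by blast
    qed (use u in simp)
    then show ?thesis using x Prime by (intro ex1I[of _ "Plain x"]) auto
  qed (use v in simp)
qed

lemma transversal_blocks_eq_common_colours:
  assumes "\<alpha> \<in> partitions m n"
  shows "{A \<in> \<alpha>. A \<inter> range Plain \<noteq> {} \<and> A \<inter> range Prime \<noteq> {}} =
    (\<lambda>v. edges \<alpha> `` {v}) ` Plain ` {1..m} \<inter> (\<lambda>v. edges \<alpha> `` {v}) ` Prime ` {1..n}"
    (is "?T = ?X \<inter> ?Y")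
proof (intro set_eqI iffI)
  fix A assume A: "A \<in> ?T"
  then obtain x y where xy: "Plain x \<in> A" "Prime y \<in> A" by blast
  then have "x \<in> {1..m}" "y \<in> {1..n}"
    using A partitionsD(1)[OF assms] vertices_simps(1,2) by blast+
  moreover have "A = edges \<alpha> `` {Plain x}" "A = edges \<alpha> `` {Prime y}"
    using A xy block_eq_edges[OF assms] by auto
  ultimately show "A \<in> ?X \<inter> ?Y" by blast
next
  fix A assume "A \<in> ?X \<inter> ?Y"
  then obtain x y where x: "x \<in> {1..m}" "A = edges \<alpha> `` {Plain x}"
    and y: "y \<in> {1..n}" "A = edges \<alpha> `` {Prime y}" by auto
  obtain B where B: "B \<in> \<alpha>" "Plain x \<in> B"
    using x(1) partitionsD(1)[OF assms] vertices_simps(1)[of x m n] by blast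
  obtain B' where B': "B' \<in> \<alpha>" "Prime y \<in> B'"
    using y(1) partitionsD(1)[OF assms] vertices_simps(2)[of y m n] by blast
  have "A = B" "A = B'" using x y B B' block_eq_edges[OF assms] by auto
  then show "A \<in> ?T" using B B' by blast
qed

text \<open>
  Every morphism factors through its rank as \<open>L O M\<inverse>\<close> where \<open>L\<close> and \<open>M\<close> have left inverses
  given by their converses.
\<close>

lemma rank_factor:
  assumes K: "diagram_category K" and \<alpha>: "\<alpha> \<in> homset K m n"
  obtains L M where "L \<in> hom_rels K m (rank \<alpha>)" "M \<in> hom_rels K n (rank \<alpha>)"
    "rel \<alpha> = L O M\<inverse>" "L\<inverse> O L = unit_rel (rank \<alpha>)" "M\<inverse> O M = unit_rel (rank \<alpha>)"
proof -
  have \<alpha>P: "\<alpha> \<in> partitions m n" and \<alpha>K: "\<alpha> \<in> K" using \<alpha> by (auto simp: homset_def)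
  define c where "c = (\<lambda>v. edges \<alpha> `` {v})"
  have c: "fibres m n c = \<alpha>" unfolding c_def by (rule fibres_edges[OF \<alpha>P])
  let ?T = "c ` Plain ` {1..m} \<inter> c ` Prime ` {1..n}"
  have "card ?T = rank \<alpha>" unfolding rank_def transversal_blocks_eq_common_colours[OF \<alpha>P] c_def ..
  then obtain t where t: "bij_betw t {1..rank \<alpha>} ?T"
    using ex_bij_betw_nat_finite_1[of ?T] by auto
  then have inj: "inj_on t {1..rank \<alpha>}" and tim: "t ` {1..rank \<alpha>} = ?T"
    by (auto simp: bij_betw_def)
  have tim': "t ` {1..rank \<alpha>} =
      (c \<circ> swap_rows) ` Plain ` {1..n} \<inter> (c \<circ> swap_rows) ` Prime ` {1..m}"
    unfolding tim by (auto simp: image_comp image_image)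
  let ?L = "colour_rel m (rank \<alpha>) (upper_half c t)"
  let ?M = "colour_rel n (rank \<alpha>) (upper_half (c \<circ> swap_rows) t)"
  have fib: "fibres m n c \<in> K" "fibres n m (c \<circ> swap_rows) \<in> K"
    using \<alpha>K fibres_comp_bij[OF K _ bij_swap_rows, of m n c] unfolding c by auto
  show thesis
  proof (rule that[of ?L ?M])
    show "?L \<in> hom_rels K m (rank \<alpha>)"
      using fib(1) paired_upper_half[OF _ inj tim] fibres_in_brauer_iff
      by (intro colour_rel_in_hom_rels fibres_in_categoryI[OF K]) blast
    show "?M \<in> hom_rels K n (rank \<alpha>)"
      using fib(2) paired_upper_half[OF _ inj tim'] fibres_in_brauer_iff
      by (intro colour_rel_in_hom_rels fibres_in_categoryI[OF K]) blast
    show "rel \<alpha> = ?L O ?M\<inverse>"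
      using upper_half_factor[OF tim] rel_fibres[of m n c] c by simp
    show "?L\<inverse> O ?L = unit_rel (rank \<alpha>)"
      by (rule upper_half_retract[OF _ inj]) (use tim in blast)
    show "?M\<inverse> O ?M = unit_rel (rank \<alpha>)"
      by (rule upper_half_retract[OF _ inj]) (use tim' in blast)
  qed
qed

text \<open>
  Choosing an intermediate set for every subset of \<open>{1..q}\<close> embeds \<open>Pow {1..q}\<close> in \<open>Pow {1..k}\<close>.
\<close>

lemma unit_rel_factor_le:
  assumes "X O Y = unit_rel q" "X \<subseteq> Pow {1..q} \<times> Pow {1..k}"
  shows "q \<le> k"
proof -
  have "\<forall>S \<in> Pow {1..q}. \<exists>U. (S, U) \<in> X \<and> (U, S) \<in> Y"
  proof
    fix S assume "S \<in> Pow {1..q}"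
    then have "(S, S) \<in> X O Y" unfolding assms(1) by (rule Id_onI)
    then show "\<exists>U. (S, U) \<in> X \<and> (U, S) \<in> Y" by (rule relcompE) auto
  qed
  then obtain \<phi> where \<phi>: "\<And>S. S \<in> Pow {1..q} \<Longrightarrow> (S, \<phi> S) \<in> X \<and> (\<phi> S, S) \<in> Y" by metis
  have "inj_on \<phi> (Pow {1..q})"
  proof (rule inj_onI)
    fix S S' assume S: "S \<in> Pow {1..q}" "S' \<in> Pow {1..q}" "\<phi> S = \<phi> S'"
    then have "(S, S') \<in> X O Y" using \<phi>[of S] \<phi>[of S'] by (metis relcomp.relcompI)
    then show "S = S'" using assms(1) by blast
  qed
  moreover have "\<phi> ` Pow {1..q} \<subseteq> Pow {1..k}" using \<phi> assms(2) by blast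
  ultimately have "card (Pow {1..q}) \<le> card (Pow {1..k})" by (rule card_inj_on_le) simp
  then show ?thesis by (simp add: card_Pow)
qed

lemma rank_le:
  assumes K: "diagram_category K" and \<alpha>: "\<alpha> \<in> homset K m n"
    and "X \<in> hom_rels K m k" "rel \<alpha> = X O Y"
  shows "rank \<alpha> \<le> k"
proof -
  obtain L M where LM: "L \<in> hom_rels K m (rank \<alpha>)" "M \<in> hom_rels K n (rank \<alpha>)"
    "rel \<alpha> = L O M\<inverse>" "L\<inverse> O L = unit_rel (rank \<alpha>)" "M\<inverse> O M = unit_rel (rank \<alpha>)"
    by (rule rank_factor[OF K \<alpha>])
  have "(L\<inverse> O X) O (Y O M) = L\<inverse> O (L O M\<inverse>) O M" unfolding LM(3)[symmetric] assms(4) by (simp only: O_assoc)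
  also have "\<dots> = (L\<inverse> O L) O (M\<inverse> O M)" by (simp only: O_assoc)
  also have "\<dots> = unit_rel (rank \<alpha>)" unfolding LM(4,5) by blast
  finally show ?thesis
  proof (rule unit_rel_factor_le)
    show "L\<inverse> O X \<subseteq> Pow {1..rank \<alpha>} \<times> Pow {1..k}"
      using hom_rels_subset[OF LM(1)] hom_rels_subset[OF assms(3)] by blast
  qed
qed

text \<open>
  The converse is a von Neumann inverse; in particular both categories are regular.
\<close>

lemma hom_rels_regular:
  assumes K: "diagram_category K" and R: "R \<in> hom_rels K m n"
  shows "R O R\<inverse> O R = R"
proof -
  obtain \<alpha> where \<alpha>: "\<alpha> \<in> homset K m n" "R = rel \<alpha>" using R by (auto simp: hom_rels_def)
  obtain L M where LM: "L \<in> hom_rels K m (rank \<alpha>)" "M \<in> hom_rels K n (rank \<alpha>)"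
    "rel \<alpha> = L O M\<inverse>" "L\<inverse> O L = unit_rel (rank \<alpha>)" "M\<inverse> O M = unit_rel (rank \<alpha>)"
    by (rule rank_factor[OF K \<alpha>(1)])
  have "R O R\<inverse> O R = L O (M\<inverse> O M) O (L\<inverse> O L) O M\<inverse>"
    unfolding \<alpha> LM(3) by (simp only: O_assoc converse_relcomp converse_converse)
  also have "\<dots> = L O M\<inverse>"
    unfolding LM(4,5) using hom_rels_subset[OF LM(1)] hom_rels_subset[OF LM(2)] by blast
  finally show ?thesis unfolding \<alpha> LM(3) .
qed

lemma finite_hom_rels: "finite (hom_rels K m n)"
proof -
  have "hom_rels K m n \<subseteq> Pow (Pow {1..m} \<times> Pow {1..n})" using hom_rels_subset by blast
  then show ?thesis by (rule finite_subset) simp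
qed

text \<open>
  In the finite endomorphism monoid of \<open>n\<close>, left multiplication by \<open>Y\<close> is injective, hence surjective.
\<close>

lemma hom_rels_one_sided_inverse:
  assumes K: "diagram_category K" and X: "X \<in> hom_rels K n n" and Y: "Y \<in> hom_rels K n n"
    and XY: "X O Y = unit_rel n"
  shows "Y O X = unit_rel n"
proof -
  have cancel: "X O Y O Z = Z" if "Z \<in> hom_rels K n n" for Z
    using unit_rel_left[OF that] unfolding XY[symmetric] by (simp only: O_assoc)
  have inj: "inj_on (\<lambda>Z. Y O Z) (hom_rels K n n)"
    by (rule inj_on_inverseI[where g = "\<lambda>Z. X O Z"]) (rule cancel)
  have sub: "(\<lambda>Z. Y O Z) ` hom_rels K n n \<subseteq> hom_rels K n n"
    using hom_rels_comp[OF K Y] by blast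
  have "(\<lambda>Z. Y O Z) ` hom_rels K n n = hom_rels K n n"
    by (rule endo_inj_surj[OF finite_hom_rels sub inj])
  then have "unit_rel n \<in> (\<lambda>Z. Y O Z) ` hom_rels K n n"
    using unit_rel_in_hom_rels[OF K] by simp
  then obtain Z where Z: "unit_rel n = Y O Z" "Z \<in> hom_rels K n n"
    by (rule imageE)
  have "Z = X" using cancel[OF Z(2)] unit_rel_right[OF X] unfolding Z(1)[symmetric] by simp
  then show ?thesis using Z(1) by simp
qed

section \<open>Retracts and their supports\<close>

text \<open>
  The morphisms from \<open>r\<close> to \<open>q\<close> whose converse is a left inverse. They are the morphisms of rank \<open>q\<close>
  that join every lower vertex to the upper row by a transversal of its own.
\<close>

definition retracts :: "partition set \<Rightarrow> nat \<Rightarrow> nat \<Rightarrow> (nat set \<times> nat set) set set" where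
  "retracts K r q = {L \<in> hom_rels K r q. L\<inverse> O L = unit_rel q}"

text \<open>
  The graph on the retracts in which \<open>L\<close> and \<open>M\<close> are adjacent iff \<open>L\<inverse> O M\<close> is the identity. Then
  \<open>L O M\<inverse>\<close> is an idempotent, and the idempotents along a path from \<open>L\<close> to \<open>M\<close> multiply to
  \<open>L O M\<inverse>\<close>.
\<close>

definition linked :: "partition set \<Rightarrow> nat \<Rightarrow> nat \<Rightarrow> (nat set \<times> nat set) set rel" where
  "linked K r q = {(L, M). L \<in> retracts K r q \<and> M \<in> retracts K r q \<and> L\<inverse> O M = unit_rel q}"

text \<open>
  The map \<open>f\<close> picks, for every lower vertex \<open>i\<close>, an upper vertex in the block of \<open>i\<close>. Only its values on
  \<open>{1..q}\<close> matter.
\<close>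

definition supports :: "nat \<Rightarrow> nat \<Rightarrow> (nat \<Rightarrow> nat) \<Rightarrow> (nat set \<times> nat set) set \<Rightarrow> bool" where
  "supports r q f L \<longleftrightarrow> f ` {1..q} \<subseteq> {1..r} \<and>
     (\<forall>U S i. (U, S) \<in> L \<longrightarrow> i \<in> {1..q} \<longrightarrow> (f i \<in> U \<longleftrightarrow> i \<in> S))"

lemma supports_colour_rel_iff:
  "supports r q f (colour_rel r q c) \<longleftrightarrow>
    f ` {1..q} \<subseteq> {1..r} \<and> (\<forall>i\<in>{1..q}. c (Plain (f i)) = c (Prime i))" (is "?L \<longleftrightarrow> ?R")
proof
  assume L: ?L
  have "c (Plain (f i)) = c (Prime i)" if i: "i \<in> {1..q}" for i
  proof -
    have "({x \<in> {1..r}. c (Plain x) \<in> {c (Prime i)}}, {y \<in> {1..q}. c (Prime y) \<in> {c (Prime i)}})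
        \<in> colour_rel r q c" unfolding colour_rel_def by blast
    then have "f i \<in> {x \<in> {1..r}. c (Plain x) \<in> {c (Prime i)}}"
      using L i unfolding supports_def by blast
    then show ?thesis by blast
  qed
  then show ?R using L unfolding supports_def by blast
next
  assume R: ?R
  have "f i \<in> U \<longleftrightarrow> i \<in> S" if US: "(U, S) \<in> colour_rel r q c" and i: "i \<in> {1..q}" for U S i
  proof -
    obtain C where C: "U = {x \<in> {1..r}. c (Plain x) \<in> C}" "S = {y \<in> {1..q}. c (Prime y) \<in> C}"
      using US unfolding colour_rel_def by blast
    have "f i \<in> {1..r}" "c (Plain (f i)) = c (Prime i)" using R i by blast+
    then show ?thesis unfolding C using i by simp
  qed
  then show ?L using R unfolding supports_def by blast
qed

lemma supportsD:
  assumes "supports r q f L" "(U, S) \<in> L" "i \<in> {1..q}"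
  shows "f i \<in> U \<longleftrightarrow> i \<in> S"
  using assms unfolding supports_def by blast

lemma retractsD:
  assumes "L \<in> retracts K r q"
  shows "L \<in> hom_rels K r q" "L\<inverse> O L = unit_rel q"
  using assms by (auto simp: retracts_def)

lemma retracts_total:
  assumes "L \<in> retracts K r q" "S \<subseteq> {1..q}"
  obtains U where "(U, S) \<in> L"
proof -
  have "(S, S) \<in> L\<inverse> O L" unfolding retractsD(2)[OF assms(1)] using assms(2) by (intro Id_onI) simp
  then show thesis using that by blast
qed

lemma supports_inj:
  assumes "L \<in> retracts K r q" "supports r q f L"
  shows "inj_on f {1..q}"
proof (rule inj_onI)
  fix i j assume ij: "i \<in> {1..q}" "j \<in> {1..q}" "f i = f j"
  obtain U where U: "(U, {i}) \<in> L" using retracts_total[OF assms(1), of "{i}"] ij by blast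
  then have "f i \<in> U" using assms(2) ij unfolding supports_def by blast
  then have "j \<in> {i}" using assms(2) ij U unfolding supports_def by metis
  then show "i = j" by simp
qed

text \<open>
  Suppose the block of the lower vertex \<open>i\<close> had no upper vertex. Its lower part would then, like the
  empty set, be related to the empty set, and \<open>L\<inverse> O L\<close> would not be the identity.
\<close>

lemma supports_exists:
  assumes L: "L \<in> retracts K r q"
  obtains f where "supports r q f L"
proof -
  obtain c :: "vertex \<Rightarrow> vertex set" where c: "L = colour_rel r q c"
    using retractsD(1)[OF L] unfolding hom_rels_iff by blast
  have "\<exists>x \<in> {1..r}. c (Plain x) = c (Prime i)" if i: "i \<in> {1..q}" for i
  proof (rule ccontr)
    assume no: "\<not> (\<exists>x \<in> {1..r}. c (Plain x) = c (Prime i))"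
    let ?T = "\<lambda>C. {y \<in> {1..q}. c (Prime y) \<in> C}"
    have mem: "({x \<in> {1..r}. c (Plain x) \<in> C}, ?T C) \<in> L" for C
      unfolding c colour_rel_def by blast
    have e: "{x \<in> {1..r}. c (Plain x) \<in> {c (Prime i)}} = {}" "{x \<in> {1..r}. c (Plain x) \<in> {}} = {}"
      using no by auto
    have "({}, ?T {c (Prime i)}) \<in> L" "({}, ?T {}) \<in> L"
      using mem[of "{c (Prime i)}"] mem[of "{}"] unfolding e .
    then have "(?T {c (Prime i)}, ?T {}) \<in> L\<inverse> O L" by blast
    then have "?T {c (Prime i)} = ?T {}" unfolding retractsD(2)[OF L] by (rule Id_onE) simp
    then show False using i by blast
  qed
  then obtain f where "\<And>i. i \<in> {1..q} \<Longrightarrow> f i \<in> {1..r} \<and> c (Plain (f i)) = c (Prime i)"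
    by metis
  then have "supports r q f L" unfolding c supports_colour_rel_iff by blast
  then show thesis by (rule that)
qed

lemma common_support_unit:
  assumes "L \<subseteq> Pow {1..r} \<times> Pow {1..q}" "M \<subseteq> Pow {1..r} \<times> Pow {1..q}"
    and "supports r q f L" "supports r q f M"
    and common: "\<And>S. S \<subseteq> {1..q} \<Longrightarrow> \<exists>U. (U, S) \<in> L \<and> (U, S) \<in> M"
  shows "L\<inverse> O M = unit_rel q"
proof (intro set_eqI iffI)
  fix z assume "z \<in> L\<inverse> O M"
  then obtain U S S' where z: "z = (S, S')" "(U, S) \<in> L" "(U, S') \<in> M" by blast
  have S: "S \<subseteq> {1..q}" "S' \<subseteq> {1..q}" using z(2,3) assms(1,2) by blast+
  have "i \<in> S \<longleftrightarrow> i \<in> S'" if "i \<in> {1..q}" for i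
    using assms(3,4) z(2,3) that unfolding supports_def by metis
  then have "S = S'" using S by blast
  then show "z \<in> unit_rel q" unfolding z(1) using S by (auto intro: Id_onI)
next
  fix z assume "z \<in> unit_rel q"
  then obtain S where z: "z = (S, S)" "S \<subseteq> {1..q}" by blast
  then show "z \<in> L\<inverse> O M" using common[OF z(2)] by blast
qed

lemma linked_if_common_support:
  assumes "L \<in> retracts K r q" "M \<in> retracts K r q" "supports r q f L" "supports r q f M"
    and "\<And>S. S \<subseteq> {1..q} \<Longrightarrow> \<exists>U. (U, S) \<in> L \<and> (U, S) \<in> M"
  shows "(L, M) \<in> linked K r q"
  unfolding linked_def
  using assms(1,2) common_support_unit[OF hom_rels_subset[OF retractsD(1)[OF assms(1)]]
      hom_rels_subset[OF retractsD(1)[OF assms(2)]] assms(3-5)] by blast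

lemma retractsI:
  assumes "L \<in> hom_rels K r q" "supports r q f L"
    and "\<And>S. S \<subseteq> {1..q} \<Longrightarrow> \<exists>U. (U, S) \<in> L"
  shows "L \<in> retracts K r q"
  unfolding retracts_def
  using assms(1) common_support_unit[OF hom_rels_subset[OF assms(1)] hom_rels_subset[OF assms(1)]
      assms(2,2)] assms(3) by blast

lemma linked_sym: "sym (linked K r q)"
proof (rule symI)
  fix L M assume LM: "(L, M) \<in> linked K r q"
  have "M\<inverse> O L = (L\<inverse> O M)\<inverse>" by blast
  also have "\<dots> = unit_rel q" using LM unfolding linked_def by auto
  finally show "(M, L) \<in> linked K r q" using LM unfolding linked_def by blast
qed

lemma linked_rtrancl_retracts:
  assumes "(L, M) \<in> (linked K r q)\<^sup>*" "L \<in> retracts K r q"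
  shows "M \<in> retracts K r q"
  using assms by (induction rule: rtrancl_induct) (auto simp: linked_def)

section \<open>Moving the support in the partition category\<close>

text \<open>
  The partial map \<open>p\<close> from the upper to the lower row, as a colouring: an upper vertex \<open>x\<close> with
  \<open>p x = Some i\<close> joins the block of the lower vertex \<open>i\<close>, every other upper vertex is a singleton.
\<close>

definition collapse :: "(nat \<Rightarrow> nat option) \<Rightarrow> vertex \<Rightarrow> vertex" where
  "collapse p v = (case v of Plain x \<Rightarrow> (case p x of Some i \<Rightarrow> Prime i | None \<Rightarrow> v) | _ \<Rightarrow> v)"

lemma collapse_simps [simp]:
  "p x = Some i \<Longrightarrow> collapse p (Plain x) = Prime i"
  "p x = None \<Longrightarrow> collapse p (Plain x) = Plain x"
  "collapse p (Prime y) = Prime y"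
  by (simp_all add: collapse_def)

lemma collapse_relI:
  assumes "U \<subseteq> {1..r}" "S \<subseteq> {1..q}"
    and "\<And>x i. x \<in> {1..r} \<Longrightarrow> p x = Some i \<Longrightarrow> x \<in> U \<longleftrightarrow> i \<in> S"
  shows "(U, S) \<in> colour_rel r q (collapse p)"
proof -
  let ?C = "Prime ` S \<union> Plain ` U"
  have "collapse p (Plain x) \<in> ?C \<longleftrightarrow> x \<in> U" if "x \<in> {1..r}" for x
    using assms(3)[OF that] by (cases "p x") auto
  then have "U = {x \<in> {1..r}. collapse p (Plain x) \<in> ?C}" using assms(1) by blast
  moreover have "S = {y \<in> {1..q}. collapse p (Prime y) \<in> ?C}" using assms(2) by auto
  ultimately show ?thesis unfolding colour_rel_def by blast
qed

lemma collapse_retract: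
  assumes "supports r q f (colour_rel r q (collapse p))"
  shows "colour_rel r q (collapse p) \<in> retracts partition_category r q"
proof (rule retractsI[OF colour_rel_in_hom_rels assms])
  fix S assume S: "S \<subseteq> {1..q}"
  have "({x \<in> {1..r}. p x \<in> Some ` S}, S) \<in> colour_rel r q (collapse p)"
    by (rule collapse_relI) (use S in auto)
  then show "\<exists>U. (U, S) \<in> colour_rel r q (collapse p)" ..
qed simp

text \<open>
  The partial inverse of \<open>f\<close> on \<open>{1..q}\<close>.
\<close>

definition support_map :: "nat \<Rightarrow> (nat \<Rightarrow> nat) \<Rightarrow> nat \<Rightarrow> nat option" where
  "support_map q f x = (if x \<in> f ` {1..q} then Some (the_inv_into {1..q} f x) else None)"

lemma support_map_image:
  assumes "inj_on f {1..q}" "i \<in> {1..q}"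
  shows "support_map q f (f i) = Some i"
  using assms by (simp add: support_map_def the_inv_into_f_f)

lemma support_map_SomeD:
  assumes "inj_on f {1..q}" "support_map q f x = Some i"
  shows "i \<in> {1..q} \<and> f i = x"
  using assms by (auto simp: support_map_def the_inv_into_f_f split: if_splits)

text \<open>
  Both retracts are adjacent to the one with blocks \<open>{Plain (f i), Prime i}\<close> and singletons.
\<close>

lemma partition_same_support:
  assumes L: "L \<in> retracts partition_category r q" "supports r q f L"
    and M: "M \<in> retracts partition_category r q" "supports r q f M"
  shows "(L, M) \<in> (linked partition_category r q)\<^sup>*"
proof -
  have inj: "inj_on f {1..q}" by (rule supports_inj[OF L])
  have sub: "f ` {1..q} \<subseteq> {1..r}" using L(2) unfolding supports_def by blast
  define E where "E = colour_rel r q (collapse (support_map q f))"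
  have Es: "supports r q f E"
    unfolding E_def supports_colour_rel_iff using sub support_map_image[OF inj] by simp
  have E: "E \<in> retracts partition_category r q"
    using Es unfolding E_def by (rule collapse_retract)
  have link: "(X, E) \<in> linked partition_category r q"
    if X: "X \<in> retracts partition_category r q" "supports r q f X" for X
  proof (rule linked_if_common_support[OF X(1) E X(2) Es])
    fix S assume S: "S \<subseteq> {1..q}"
    obtain U where U: "(U, S) \<in> X" using retracts_total[OF X(1) S] by blast
    have "(U, S) \<in> E"
      unfolding E_def
    proof (rule collapse_relI)
      show "U \<subseteq> {1..r}" using U hom_rels_subset[OF retractsD(1)[OF X(1)]] by blast
      show "x \<in> U \<longleftrightarrow> i \<in> S" if "support_map q f x = Some i" for x i
        using support_map_SomeD[OF inj that] X(2) U unfolding supports_def by blast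
    qed (rule S)
    then show "\<exists>U. (U, S) \<in> X \<and> (U, S) \<in> E" using U by blast
  qed
  have "(E, M) \<in> linked partition_category r q"
    using link[OF M] linked_sym by (rule symD[rotated])
  then show ?thesis using link[OF L] by (rule converse_rtrancl_into_rtrancl[OF _ r_into_rtrancl, rotated])
qed

text \<open>
  The blocks \<open>{Plain (f i), Plain a, Prime i}\<close> and \<open>{Plain (f j), Prime j}\<close> for \<open>j \<noteq> i\<close> are supported both
  by \<open>f\<close> and by \<open>f(i := a)\<close>.
\<close>

lemma partition_move:
  assumes L: "L \<in> retracts partition_category r q" "supports r q f L"
    and i: "i \<in> {1..q}" and a: "a \<in> {1..r}" "a \<notin> f ` {1..q}"
  shows "\<exists>M. supports r q (f(i := a)) M \<and> (L, M) \<in> (linked partition_category r q)\<^sup>*"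
proof -
  have inj: "inj_on f {1..q}" by (rule supports_inj[OF L])
  have sub: "f ` {1..q} \<subseteq> {1..r}" using L(2) unfolding supports_def by blast
  define E where "E = colour_rel r q (collapse ((support_map q f)(a := Some i)))"
  have f: "((support_map q f)(a := Some i)) (f j) = Some j" if "j \<in> {1..q}" for j
    using that a(2) support_map_image[OF inj that] by auto
  have Es: "supports r q f E"
    unfolding E_def supports_colour_rel_iff using sub f by simp
  have Es': "supports r q (f(i := a)) E"
    unfolding E_def supports_colour_rel_iff
  proof (intro conjI ballI)
    show "(f(i := a)) ` {1..q} \<subseteq> {1..r}" using sub a by auto
    fix j assume j: "j \<in> {1..q}"
    show "collapse ((support_map q f)(a := Some i)) (Plain ((f(i := a)) j)) =
        collapse ((support_map q f)(a := Some i)) (Prime j)"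
      using f[OF j] by (cases "j = i") simp_all
  qed
  have "E \<in> retracts partition_category r q"
    using Es unfolding E_def by (rule collapse_retract)
  then show ?thesis using partition_same_support[OF L _ Es] Es' by blast
qed

section \<open>Moving the support in the Brauer category\<close>

lemma brauer_colour:
  assumes "L \<in> retracts brauer_category r q" "supports r q f L"
  obtains c :: "vertex \<Rightarrow> vertex set" where "L = colour_rel r q c" "paired r q c"
    "\<And>i. i \<in> {1..q} \<Longrightarrow> f i \<in> {1..r} \<and> c (Plain (f i)) = c (Prime i)"
proof -
  obtain c :: "vertex \<Rightarrow> vertex set" where c: "fibres r q c \<in> brauer_category" "L = colour_rel r q c"
    using retractsD(1)[OF assms(1)] unfolding hom_rels_iff by blast
  show thesis
  proof (rule that[of c])
    show "paired r q c" using c(1) fibres_in_brauer_iff by blast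
    show "f i \<in> {1..r} \<and> c (Plain (f i)) = c (Prime i)" if "i \<in> {1..q}" for i
      using assms(2) that unfolding c(2) supports_colour_rel_iff by blast
  qed (rule c)
qed

lemma paired_colour_class:
  assumes c: "paired r q c" and f: "\<And>i. i \<in> {1..q} \<Longrightarrow> f i \<in> {1..r} \<and> c (Plain (f i)) = c (Prime i)"
    and i: "i \<in> {1..q}"
  shows "x \<in> {1..r} \<Longrightarrow> c (Plain x) = c (Prime i) \<Longrightarrow> x = f i"
    and "j \<in> {1..q} \<Longrightarrow> c (Prime j) = c (Prime i) \<Longrightarrow> j = i"
proof -
  have fi: "Plain (f i) \<in> vertices r q" "c (Plain (f i)) = c (Prime i)" using f[OF i] by auto
  have pi: "Prime i \<in> vertices r q" using i by simp
  show "x = f i" if x: "x \<in> {1..r}" "c (Plain x) = c (Prime i)"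
  proof -
    have "Plain x = Plain (f i)"
      by (rule paired_unique[OF c pi _ _ _ fi(1) _ fi(2)]) (use x in simp_all)
    then show ?thesis by simp
  qed
  show "j = i" if j: "j \<in> {1..q}" "c (Prime j) = c (Prime i)"
  proof (rule ccontr)
    assume "j \<noteq> i"
    have "Prime j = Plain (f i)"
      by (rule paired_unique[OF c pi _ _ _ fi(1) _ fi(2)]) (use j \<open>j \<noteq> i\<close> in simp_all)
    then show False by simp
  qed
qed

lemma paired_image_rel:
  assumes c: "paired r q c" and f: "\<And>i. i \<in> {1..q} \<Longrightarrow> f i \<in> {1..r} \<and> c (Plain (f i)) = c (Prime i)"
    and S: "S \<subseteq> {1..q}"
  shows "(f ` S, S) \<in> colour_rel r q c"
proof -
  note colour_class = paired_colour_class[OF c f]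
  let ?C = "c ` Prime ` S"
  have "f ` S = {x \<in> {1..r}. c (Plain x) \<in> ?C}"
  proof (intro set_eqI iffI)
    fix x assume "x \<in> f ` S"
    then obtain i where "i \<in> S" "x = f i" by blast
    then show "x \<in> {x \<in> {1..r}. c (Plain x) \<in> ?C}" using f S by auto
  next
    fix x assume "x \<in> {x \<in> {1..r}. c (Plain x) \<in> ?C}"
    then obtain i where i: "x \<in> {1..r}" "i \<in> S" "c (Plain x) = c (Prime i)" by auto
    then have "x = f i" using colour_class(1) S by blast
    then show "x \<in> f ` S" using i by blast
  qed
  moreover have "S = {y \<in> {1..q}. c (Prime y) \<in> ?C}"
  proof (intro set_eqI iffI)
    fix y assume "y \<in> {y \<in> {1..q}. c (Prime y) \<in> ?C}"
    then obtain i where "y \<in> {1..q}" "i \<in> S" "c (Prime y) = c (Prime i)" by auto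
    then show "y \<in> S" using colour_class(2) S by blast
  qed (use S in auto)
  ultimately show ?thesis unfolding colour_rel_def by blast
qed

text \<open>
  Retracts with the same support only differ in how they pair the remaining upper vertices. In the
  product \<open>L\<inverse> O M\<close> these lie in components without outer vertices.
\<close>

lemma brauer_same_support:
  assumes L: "L \<in> retracts brauer_category r q" "supports r q f L"
    and M: "M \<in> retracts brauer_category r q" "supports r q f M"
  shows "(L, M) \<in> linked brauer_category r q"
proof (rule linked_if_common_support[OF L(1) M(1) L(2) M(2)])
  fix S assume S: "S \<subseteq> {1..q}"
  have "(f ` S, S) \<in> X" if "X \<in> retracts brauer_category r q" "supports r q f X" for X
    using brauer_colour[OF that] paired_image_rel[OF _ _ S] by metis
  then show "\<exists>U. (U, S) \<in> L \<and> (U, S) \<in> M" using L M by blast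
qed

text \<open>
  Let \<open>b\<close> be the partner of the free vertex \<open>a\<close>. Exchanging \<open>a\<close> and \<open>f i\<close> turns the blocks
  \<open>{Plain (f i), Prime i}\<close> and \<open>{Plain a, Plain b}\<close> into \<open>{Plain a, Prime i}\<close> and \<open>{Plain (f i), Plain b}\<close>.
  In the product of the reflected old and the new retract, the path \<open>f i\<close>, \<open>b\<close>, \<open>a\<close> joins \<open>i\<close> to \<open>i\<close>.
\<close>

lemma brauer_move:
  assumes L: "L \<in> retracts brauer_category r q" "supports r q f L"
    and i: "i \<in> {1..q}" and a: "a \<in> {1..r}" "a \<notin> f ` {1..q}"
  shows "\<exists>M. supports r q (f(i := a)) M \<and> (L, M) \<in> (linked brauer_category r q)\<^sup>*"
proof -
  obtain c :: "vertex \<Rightarrow> vertex set" where Lc: "L = colour_rel r q c" and c: "paired r q c"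
    and f: "\<And>i. i \<in> {1..q} \<Longrightarrow> f i \<in> {1..r} \<and> c (Plain (f i)) = c (Prime i)"
    using brauer_colour[OF L] by blast
  have inj: "inj_on f {1..q}" by (rule supports_inj[OF L])
  have fi: "f i \<in> {1..r}" "c (Plain (f i)) = c (Prime i)" using f[OF i] by auto
  have aV: "Plain a \<in> vertices r q" using a by simp
  have a_prime: "c (Plain a) \<noteq> c (Prime j)" if "j \<in> {1..q}" for j
    using paired_colour_class(1)[OF c f that a(1)] a(2) that by blast
  obtain w where w: "w \<in> vertices r q" "w \<noteq> Plain a" "c w = c (Plain a)"
    and w_uniq: "\<And>u. u \<in> vertices r q \<Longrightarrow> u \<noteq> Plain a \<Longrightarrow> c u = c (Plain a) \<Longrightarrow> u = w"
    using pairedD[OF c aV] by blast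
  obtain b where b: "w = Plain b"
    using w a_prime by (cases w) auto
  have b1: "b \<in> {1..r}" "b \<noteq> a" "c (Plain b) = c (Plain a)" using w b by auto
  have bf: "b \<noteq> f j" if "j \<in> {1..q}" for j
    using a_prime[OF that] f[OF that] b1(3) by auto
  have class_of_a: "x = a \<or> x = b" if "x \<in> {1..r}" "c (Plain x) = c (Plain a)" for x
    using w_uniq[of "Plain x"] that b by auto
  have fia: "f i \<noteq> a" using a(2) i by blast
  define g where "g v = (if v = Plain (f i) then Plain a else if v = Plain a then Plain (f i) else v)"
    for v
  have g [simp]: "g (Plain (f i)) = Plain a" "g (Plain a) = Plain (f i)" "g (Prime y) = Prime y"
    "x \<noteq> f i \<Longrightarrow> x \<noteq> a \<Longrightarrow> g (Plain x) = Plain x" for x y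
    by (auto simp: g_def)
  have gb: "g (Plain b) = Plain b" using b1 bf[OF i] by simp
  have "bij_betw g (vertices r q) (vertices r q)"
    by (rule bij_betw_byWitness[where f' = g]) (use fi aV in \<open>auto simp: g_def\<close>)
  then have cg: "paired r q (c \<circ> g)" using c by (rule paired_comp_bij)
  define M where "M = colour_rel r q (c \<circ> g)"
  have Mh: "M \<in> hom_rels brauer_category r q"
    unfolding M_def using cg fibres_in_brauer_iff[of r q "c \<circ> g"] by (intro colour_rel_in_hom_rels) blast
  have f': "(f(i := a)) j \<in> {1..r} \<and> (c \<circ> g) (Plain ((f(i := a)) j)) = (c \<circ> g) (Prime j)"
    if j: "j \<in> {1..q}" for j
  proof (cases "j = i")
    case True
    then show ?thesis using a fi by simp
  next
    case False
    then have "f j \<noteq> f i" "f j \<noteq> a" using inj_onD[OF inj _ j i] a(2) j by auto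
    then show ?thesis using False f[OF j] by simp
  qed
  have Ms: "supports r q (f(i := a)) M" unfolding M_def supports_colour_rel_iff using f' by blast
  have Mr: "M \<in> retracts brauer_category r q"
  proof (rule retractsI[OF Mh Ms])
    fix S assume "S \<subseteq> {1..q}"
    then show "\<exists>U. (U, S) \<in> M" unfolding M_def using paired_image_rel[OF cg f'] by blast
  qed
  have "L\<inverse> O M = unit_rel q"
  proof (intro set_eqI iffI)
    fix z assume "z \<in> L\<inverse> O M"
    then obtain U S S' where z: "z = (S, S')" and US: "(U, S) \<in> L" "(U, S') \<in> M" by blast
    have S: "S \<subseteq> {1..q}" "S' \<subseteq> {1..q}"
      using US hom_rels_subset[OF Mh] hom_rels_subset[OF retractsD(1)[OF L(1)]] by blast+
    \<comment> \<open>Both relations couple \<open>b\<close> with one of \<open>a\<close> and \<open>f i\<close>.\<close>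
    have ab: "a \<in> U \<longleftrightarrow> b \<in> U"
    proof -
      obtain C where "U = {x \<in> {1..r}. c (Plain x) \<in> C}" using US(1) unfolding Lc colour_rel_def by blast
      then show ?thesis using a b1 by simp
    qed
    have fb: "f i \<in> U \<longleftrightarrow> b \<in> U"
    proof -
      obtain C where "U = {x \<in> {1..r}. (c \<circ> g) (Plain x) \<in> C}"
        using US(2) unfolding M_def colour_rel_def by blast
      then show ?thesis using fi b1 gb by simp
    qed
    have sL: "f j \<in> U \<longleftrightarrow> j \<in> S" and sM: "(f(i := a)) j \<in> U \<longleftrightarrow> j \<in> S'" if "j \<in> {1..q}" for j
      using supportsD[OF L(2) US(1) that] supportsD[OF Ms US(2) that] .
    have "j \<in> S \<longleftrightarrow> j \<in> S'" if j: "j \<in> {1..q}" for j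
    proof (cases "j = i")
      case True
      then show ?thesis using sL[OF i] sM[OF i] ab fb by simp
    next
      case False
      then show ?thesis using sL[OF j] sM[OF j] by simp
    qed
    then have "S = S'" using S by blast
    then show "z \<in> unit_rel q" unfolding z using S by (auto intro: Id_onI)
  next
    fix z assume "z \<in> unit_rel q"
    then obtain S where z: "z = (S, S)" "S \<subseteq> {1..q}" by blast
    have L0: "(f ` S, S) \<in> L" unfolding Lc by (rule paired_image_rel[OF c f z(2)])
    have M0: "((f(i := a)) ` S, S) \<in> M" unfolding M_def by (rule paired_image_rel[OF cg f' z(2)])
    have "\<exists>U. (U, S) \<in> L \<and> (U, S) \<in> M"
    proof (cases "i \<in> S")
      case False
      then have "(f(i := a)) ` S = f ` S" by (intro image_cong) auto
      then show ?thesis using L0 M0 by auto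
    next
      case True
      \<comment> \<open>The block \<open>{a, b}\<close> of \<open>L\<close> and the block \<open>{f i, b}\<close> of \<open>M\<close> may be added freely.\<close>
      have "(f ` S \<union> {a, b}, S) \<in> L"
      proof -
        obtain C where C: "f ` S = {x \<in> {1..r}. c (Plain x) \<in> C}" "S = {y \<in> {1..q}. c (Prime y) \<in> C}"
          using L0 unfolding Lc colour_rel_def by blast
        let ?C = "insert (c (Plain a)) C"
        have "c (Plain x) = c (Plain a) \<longleftrightarrow> x = a \<or> x = b" if "x \<in> {1..r}" for x
          using class_of_a[OF that] b1(3) by metis
        then have "f ` S \<union> {a, b} = {x \<in> {1..r}. c (Plain x) \<in> ?C}"
          unfolding C(1) using a(1) b1(1) by blast
        moreover have "c (Prime y) \<in> ?C \<longleftrightarrow> c (Prime y) \<in> C" if "y \<in> {1..q}" for y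
          using a_prime[OF that] by auto
        then have "S = {y \<in> {1..q}. c (Prime y) \<in> ?C}" using C(2) by blast
        ultimately show ?thesis unfolding Lc colour_rel_def by blast
      qed
      moreover have "((f(i := a)) ` S \<union> {f i, b}, S) \<in> M"
      proof -
        obtain C where C: "(f(i := a)) ` S = {x \<in> {1..r}. (c \<circ> g) (Plain x) \<in> C}"
            "S = {y \<in> {1..q}. (c \<circ> g) (Prime y) \<in> C}"
          using M0 unfolding M_def colour_rel_def by blast
        let ?C = "insert (c (Plain a)) C"
        have cls: "(c \<circ> g) (Plain x) = c (Plain a) \<longleftrightarrow> x = f i \<or> x = b" if "x \<in> {1..r}" for x
        proof -
          consider "x = f i" | "x = a" | "x \<noteq> f i" "x \<noteq> a" by blast
          then show ?thesis
          proof cases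
            case 1
            then show ?thesis by simp
          next
            case 2
            have "c (Plain (f i)) \<noteq> c (Plain a)" using fi(2) a_prime[OF i] by metis
            then show ?thesis using 2 fia b1(2) by simp
          next
            case 3
            then have "(c \<circ> g) (Plain x) = c (Plain x)" by simp
            then show ?thesis using class_of_a[OF that] b1(3) 3 by metis
          qed
        qed
        have "(f(i := a)) ` S \<union> {f i, b} = {x \<in> {1..r}. (c \<circ> g) (Plain x) \<in> ?C}"
          unfolding C(1) using cls fi(1) b1(1) by blast
        moreover have "(c \<circ> g) (Prime y) \<in> ?C \<longleftrightarrow> (c \<circ> g) (Prime y) \<in> C" if "y \<in> {1..q}" for y
          using a_prime[OF that] by auto
        then have "S = {y \<in> {1..q}. (c \<circ> g) (Prime y) \<in> ?C}" using C(2) by blast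
        ultimately show ?thesis unfolding M_def colour_rel_def by blast
      qed
      moreover have "f ` S \<union> {a, b} = (f(i := a)) ` S \<union> {f i, b}"
      proof -
        have "f ` S = insert (f i) (f ` (S - {i}))" using True by blast
        moreover have "(f(i := a)) ` S = insert a (f ` (S - {i}))"
        proof -
          have "(f(i := a)) ` S = insert ((f(i := a)) i) ((f(i := a)) ` (S - {i}))" using True by blast
          also have "(f(i := a)) ` (S - {i}) = f ` (S - {i})" by (intro image_cong) auto
          finally show ?thesis by simp
        qed
        ultimately show ?thesis by auto
      qed
      ultimately show ?thesis by metis
    qed
    then show "z \<in> L\<inverse> O M" unfolding z by blast
  qed
  then have "(L, M) \<in> linked brauer_category r q" using L(1) Mr unfolding linked_def by blast
  then show ?thesis using Ms by blast
qed

section \<open>Connectedness of the graph of retracts\<close>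

lemma same_support_connected:
  assumes "diagram_category K"
    and "L \<in> retracts K r q" "supports r q f L" "M \<in> retracts K r q" "supports r q f M"
  shows "(L, M) \<in> (linked K r q)\<^sup>*"
  using assms partition_same_support[of L r q f M] brauer_same_support[of L r q f M]
  unfolding diagram_category_def by blast

lemma support_move:
  assumes "diagram_category K" "L \<in> retracts K r q" "supports r q f L"
    and "i \<in> {1..q}" "a \<in> {1..r}" "a \<notin> f ` {1..q}"
  obtains M where "M \<in> retracts K r q" "supports r q (f(i := a)) M" "(L, M) \<in> (linked K r q)\<^sup>*"
proof -
  obtain M where M: "supports r q (f(i := a)) M" "(L, M) \<in> (linked K r q)\<^sup>*"
    using assms partition_move[of L r q f i a] brauer_move[of L r q f i a]
    unfolding diagram_category_def by blast
  then show thesis using that linked_rtrancl_retracts[OF M(2) assms(2)] by blast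
qed

text \<open>
  Any injection of \<open>{1..q}\<close> into the larger set \<open>{1..r}\<close> can be turned into any other one by moving one
  value at a time to a free place. If the target \<open>g i\<close> of a misplaced \<open>i\<close> is occupied by \<open>f j\<close>, then
  \<open>j\<close> is misplaced too and first gives way to a free place.
\<close>

lemma retracts_with_supports_connected:
  assumes K: "diagram_category K" and "q < r"
    and M: "M \<in> retracts K r q" "supports r q g M"
    and L: "L \<in> retracts K r q" "supports r q f L"
  shows "(L, M) \<in> (linked K r q)\<^sup>*"
  using L
proof (induction "card {i \<in> {1..q}. f i \<noteq> g i}" arbitrary: L f rule: less_induct)
  case less
  have g: "inj_on g {1..q}" "g ` {1..q} \<subseteq> {1..r}"
    using supports_inj[OF M] M(2) unfolding supports_def by blast+
  have f: "inj_on f {1..q}" "f ` {1..q} \<subseteq> {1..r}"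
    using supports_inj[OF less.prems] less.prems(2) unfolding supports_def by blast+
  show ?case
  proof (cases "\<exists>i \<in> {1..q}. f i \<noteq> g i")
    case False
    then have "supports r q g L" using less.prems(2) unfolding supports_def by (metis image_cong)
    then show ?thesis using same_support_connected[OF K less.prems(1) _ M] by blast
  next
    case True
    then obtain i where i: "i \<in> {1..q}" "f i \<noteq> g i" by blast
    have gi: "g i \<in> {1..r}" using g(2) i(1) by blast
    \<comment> \<open>It suffices to reach a retract whose support differs from \<open>g\<close> at fewer places.\<close>
    have close: ?thesis
      if L': "L' \<in> retracts K r q" "supports r q (f'(i := g i)) L'" "(L, L') \<in> (linked K r q)\<^sup>*"
        and f': "\<And>j. j \<in> {1..q} \<Longrightarrow> f j = g j \<Longrightarrow> f' j = g j" for L' f'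
    proof -
      have "{j \<in> {1..q}. (f'(i := g i)) j \<noteq> g j} \<subset> {j \<in> {1..q}. f j \<noteq> g j}"
        using f' i by auto
      then have "card {j \<in> {1..q}. (f'(i := g i)) j \<noteq> g j} < card {j \<in> {1..q}. f j \<noteq> g j}"
        by (intro psubset_card_mono) auto
      then have "(L', M) \<in> (linked K r q)\<^sup>*" by (rule less.hyps[OF _ L'(1,2)])
      then show ?thesis by (rule rtrancl_trans[OF L'(3)])
    qed
    show ?thesis
    proof (cases "g i \<in> f ` {1..q}")
      case False
      then obtain L' where "L' \<in> retracts K r q" "supports r q (f(i := g i)) L'"
        "(L, L') \<in> (linked K r q)\<^sup>*"
        using support_move[OF K less.prems i(1) gi] by blast
      then show ?thesis by (rule close)
    next
      case True
      then obtain j where j: "j \<in> {1..q}" "g i = f j" by blast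
      then have "j \<noteq> i" using i by auto
      then have "g j \<noteq> f j" using j i(1) inj_onD[OF g(1) _ j(1) i(1)] by metis
      have "card (f ` {1..q}) = q" using f(1) by (simp add: card_image)
      then have "f ` {1..q} \<noteq> {1..r}" using \<open>q < r\<close> by auto
      then obtain a where a: "a \<in> {1..r}" "a \<notin> f ` {1..q}" using f(2) by blast
      obtain L1 where L1: "L1 \<in> retracts K r q" "supports r q (f(j := a)) L1"
        "(L, L1) \<in> (linked K r q)\<^sup>*"
        using support_move[OF K less.prems j(1) a] by blast
      have "g i \<notin> (f(j := a)) ` {1..q}"
      proof
        assume "g i \<in> (f(j := a)) ` {1..q}"
        then obtain k where k: "k \<in> {1..q}" "f j = (f(j := a)) k" using j(2) by auto
        show False
        proof (cases "k = j")
          case True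
          then show False using k a(2) j(1) by auto
        next
          case False
          then show False using k inj_onD[OF f(1) _ j(1) k(1)] by auto
        qed
      qed
      then obtain L2 where L2: "L2 \<in> retracts K r q" "supports r q ((f(j := a))(i := g i)) L2"
        "(L1, L2) \<in> (linked K r q)\<^sup>*"
        using support_move[OF K L1(1,2) i(1) gi] by blast
      show ?thesis
      proof (rule close[OF L2(1,2)])
        show "(L, L2) \<in> (linked K r q)\<^sup>*" using L1(3) L2(3) by (rule rtrancl_trans)
        show "(f(j := a)) k = g k" if "f k = g k" for k
          using that \<open>g j \<noteq> f j\<close> by auto
      qed
    qed
  qed
qed

lemma retracts_connected:
  assumes "diagram_category K" "q < r" "L \<in> retracts K r q" "M \<in> retracts K r q"
  shows "(L, M) \<in> (linked K r q)\<^sup>*"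
proof -
  obtain f where f: "supports r q f L" by (rule supports_exists[OF assms(3)])
  obtain g where g: "supports r q g M" by (rule supports_exists[OF assms(4)])
  show ?thesis by (rule retracts_with_supports_connected[OF assms(1,2,4) g assms(3) f])
qed

section \<open>Generating by idempotents\<close>

lemma unit_cancel:
  assumes "X O Y = unit_rel r" "Z \<in> hom_rels K r k"
  shows "X O Y O Z = Z"
  using unit_rel_left[OF assms(2)] unfolding assms(1)[symmetric] by (simp only: O_assoc)

lemma rel_as_retracts:
  assumes K: "diagram_category K" and "\<alpha> \<in> homset K m n"
  obtains L M where "L \<in> retracts K m (rank \<alpha>)" "M \<in> retracts K n (rank \<alpha>)" "rel \<alpha> = L O M\<inverse>"
proof -
  obtain L M where "L \<in> hom_rels K m (rank \<alpha>)" "M \<in> hom_rels K n (rank \<alpha>)"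
    "rel \<alpha> = L O M\<inverse>" "L\<inverse> O L = unit_rel (rank \<alpha>)" "M\<inverse> O M = unit_rel (rank \<alpha>)"
    by (rule rank_factor[OF assms])
  then show thesis by (intro that[of L M]) (simp_all add: retracts_def)
qed

text \<open>
  For \<open>A\<close> and \<open>B\<close> retracts to \<open>r\<close>, the map sending \<open>Y\<close> to \<open>B O Y O A\<inverse>\<close> takes products in the
  endomorphism monoid of \<open>r\<close> to sandwich products with \<open>A O B\<inverse>\<close> in the middle. In particular
  it lifts the idempotents along the path to sandwich idempotents.
\<close>

lemma linked_product_generated:
  assumes K: "diagram_category K"
    and A: "A \<in> retracts K n r" and B: "B \<in> retracts K m r"
    and idem: "\<And>R. R \<in> hom_rels K m n \<Longrightarrow> R O (A O B\<inverse>) O R = R \<Longrightarrow> R \<in> G"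
    and mult: "\<And>R S. R \<in> G \<Longrightarrow> S \<in> G \<Longrightarrow> R O (A O B\<inverse>) O S \<in> G"
    and path: "(L, M) \<in> (linked K r q)\<^sup>*" and L: "L \<in> retracts K r q"
  shows "B O L O M\<inverse> O A\<inverse> \<in> G"
proof -
  note hom = hom_rels_comp[OF K] hom_rels_converse[OF K]
  note Ah = retractsD(1)[OF A] and Bh = retractsD(1)[OF B]
  \<comment> \<open>A single edge yields an idempotent.\<close>
  have edge: "B O X O Y\<inverse> O A\<inverse> \<in> G" if XY: "(X, Y) \<in> linked K r q" for X Y
  proof (rule idem)
    have X: "X \<in> hom_rels K r q" and Y: "Y \<in> hom_rels K r q" and "X\<inverse> O Y = unit_rel q"
      using XY unfolding linked_def retracts_def by blast+
    have YX: "Y\<inverse> O X = unit_rel q"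
      using XY linked_sym[of K r q] unfolding sym_def linked_def by blast
    show "B O X O Y\<inverse> O A\<inverse> \<in> hom_rels K m n"
      by (intro hom_rels_comp[OF K Bh] hom_rels_comp[OF K X] hom_rels_comp[OF K hom(2)[OF Y]]
          hom(2)[OF Ah])
    have YA: "Y\<inverse> O A\<inverse> \<in> hom_rels K q n"
      by (rule hom_rels_comp[OF K hom(2)[OF Y] hom(2)[OF Ah]])
    have XYA: "X O Y\<inverse> O A\<inverse> \<in> hom_rels K r n" by (rule hom_rels_comp[OF K X YA])
    have "(B O X O Y\<inverse> O A\<inverse>) O (A O B\<inverse>) O B O X O Y\<inverse> O A\<inverse> =
        B O X O Y\<inverse> O (A\<inverse> O A O (B\<inverse> O B O (X O Y\<inverse> O A\<inverse>)))"
      by (simp only: O_assoc)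
    also have "\<dots> = B O X O (Y\<inverse> O X O (Y\<inverse> O A\<inverse>))"
      unfolding unit_cancel[OF retractsD(2)[OF B] XYA] unit_cancel[OF retractsD(2)[OF A] XYA] ..
    also have "\<dots> = B O X O Y\<inverse> O A\<inverse>" unfolding unit_cancel[OF YX YA] ..
    finally show "(B O X O Y\<inverse> O A\<inverse>) O (A O B\<inverse>) O B O X O Y\<inverse> O A\<inverse> = B O X O Y\<inverse> O A\<inverse>" .
  qed
  show ?thesis using path
  proof (induction rule: rtrancl_induct)
    case base
    show ?case using edge[of L L] L retractsD(2)[OF L] unfolding linked_def by blast
  next
    case (step M N)
    have M: "M \<in> retracts K r q" and N: "N \<in> retracts K r q"
      using step.hyps(2) unfolding linked_def by blast+
    note Mh = retractsD(1)[OF M] and Nh = retractsD(1)[OF N]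
    have NA: "N\<inverse> O A\<inverse> \<in> hom_rels K q n"
      by (rule hom_rels_comp[OF K hom(2)[OF Nh] hom(2)[OF Ah]])
    have MNA: "M O N\<inverse> O A\<inverse> \<in> hom_rels K r n" by (rule hom_rels_comp[OF K Mh NA])
    have "(B O L O M\<inverse> O A\<inverse>) O (A O B\<inverse>) O B O M O N\<inverse> O A\<inverse> =
        B O L O M\<inverse> O (A\<inverse> O A O (B\<inverse> O B O (M O N\<inverse> O A\<inverse>)))"
      by (simp only: O_assoc)
    also have "\<dots> = B O L O (M\<inverse> O M O (N\<inverse> O A\<inverse>))"
      unfolding unit_cancel[OF retractsD(2)[OF B] MNA] unit_cancel[OF retractsD(2)[OF A] MNA] ..
    also have "\<dots> = B O L O N\<inverse> O A\<inverse>" unfolding unit_cancel[OF retractsD(2)[OF M] NA] ..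
    finally show ?case using mult[OF step.IH edge[OF step.hyps(2)]] by simp
  qed
qed

text \<open>
  Let \<open>R = rel \<alpha>\<close> be regular in the sandwich semigroup, with sandwich inverse \<open>T\<close>. The compression
  \<open>B\<inverse> O R O A\<close> to \<open>r\<close> has rank less than \<open>r\<close>, so its lift \<open>W\<close> is a product of idempotents. The
  relation \<open>R\<close> itself is recovered by multiplying \<open>W\<close> by the idempotents \<open>R O S O T\<close> and
  \<open>T O S O R\<close> on the left and on the right.
\<close>

lemma low_rank_generated:
  assumes K: "diagram_category K" and \<alpha>: "\<alpha> \<in> homset K m n" and "rank \<alpha> < r"
    and A: "A \<in> retracts K n r" and B: "B \<in> retracts K m r"
    and S: "S = A O B\<inverse>"
    and T: "T \<in> hom_rels K m n" and reg: "rel \<alpha> = rel \<alpha> O S O T O S O rel \<alpha>"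
    and idem: "\<And>R. R \<in> hom_rels K m n \<Longrightarrow> R O S O R = R \<Longrightarrow> R \<in> G"
    and mult: "\<And>R R'. R \<in> G \<Longrightarrow> R' \<in> G \<Longrightarrow> R O S O R' \<in> G"
  shows "rel \<alpha> \<in> G"
proof -
  note Ah = retractsD(1)[OF A] and Bh = retractsD(1)[OF B]
  define R where "R = rel \<alpha>"
  have R: "R \<in> hom_rels K m n" using \<alpha> unfolding R_def hom_rels_def by blast
  have reg: "R O S O T O S O R = R" using reg unfolding R_def by simp
  have Sh: "S \<in> hom_rels K n m" unfolding S by (rule hom_rels_comp[OF K Ah hom_rels_converse[OF K Bh]])
  obtain L0 M0 where L0: "L0 \<in> retracts K m (rank \<alpha>)" and M0: "M0 \<in> retracts K n (rank \<alpha>)"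
    and R0: "R = L0 O M0\<inverse>"
    unfolding R_def by (rule rel_as_retracts[OF K \<alpha>])
  have BRA: "B\<inverse> O R O A \<in> hom_rels K r r"
    by (rule hom_rels_comp[OF K hom_rels_converse[OF K Bh] hom_rels_comp[OF K R Ah]])
  then obtain \<eta> where \<eta>: "\<eta> \<in> homset K r r" "rel \<eta> = B\<inverse> O R O A"
    unfolding hom_rels_def by auto
  have "rank \<eta> \<le> rank \<alpha>"
  proof (rule rank_le[OF K \<eta>(1)])
    show "B\<inverse> O L0 \<in> hom_rels K r (rank \<alpha>)"
      by (rule hom_rels_comp[OF K hom_rels_converse[OF K Bh] retractsD(1)[OF L0]])
    show "rel \<eta> = (B\<inverse> O L0) O (M0\<inverse> O A)" unfolding \<eta>(2) R0 by (simp only: O_assoc)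
  qed
  then have "rank \<eta> < r" using \<open>rank \<alpha> < r\<close> by simp
  obtain L M where L: "L \<in> retracts K r (rank \<eta>)" and M: "M \<in> retracts K r (rank \<eta>)"
    and LM: "rel \<eta> = L O M\<inverse>"
    by (rule rel_as_retracts[OF K \<eta>(1)])
  have path: "(L, M) \<in> (linked K r (rank \<eta>))\<^sup>*"
    by (rule retracts_connected[OF K \<open>rank \<eta> < r\<close> L M])
  define W where "W = B O L O M\<inverse> O A\<inverse>"
  have W: "W \<in> G"
    unfolding W_def by (rule linked_product_generated[OF K A B idem[unfolded S] mult[unfolded S] path L])
  have Bs: "B\<inverse> \<in> hom_rels K r m" by (rule hom_rels_converse[OF K Bh])
  have RAB: "R O A O B\<inverse> \<in> hom_rels K m m" using hom_rels_comp[OF K R Sh] unfolding S .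
  have BRAB: "B\<inverse> O R O A O B\<inverse> \<in> hom_rels K r m" by (rule hom_rels_comp[OF K Bs RAB])
  have "S O W O S = A O (B\<inverse> O B O (L O M\<inverse> O (A\<inverse> O A O B\<inverse>)))"
    unfolding S W_def by (simp only: O_assoc)
  also have "\<dots> = A O (B\<inverse> O B O ((L O M\<inverse>) O B\<inverse>))"
    unfolding unit_cancel[OF retractsD(2)[OF A] Bs] by (simp only: O_assoc)
  also have "\<dots> = A O (B\<inverse> O B O (B\<inverse> O R O A O B\<inverse>))"
    unfolding LM[symmetric] \<eta>(2) by (simp only: O_assoc)
  also have "\<dots> = S O R O S"
    unfolding unit_cancel[OF retractsD(2)[OF B] BRAB] S by (simp only: O_assoc)
  finally have SWS: "S O W O S = S O R O S" .
  have ST: "S O T \<in> hom_rels K n n" by (rule hom_rels_comp[OF K Sh T])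
  have absorb: "R O S O T O S O R O X = R O X" for X
    using arg_cong[OF reg, of "\<lambda>Y. Y O X"] by (simp only: O_assoc)
  have P: "R O S O T \<in> G"
  proof (rule idem)
    show "R O S O T \<in> hom_rels K m n" by (rule hom_rels_comp[OF K R ST])
    show "(R O S O T) O S O R O S O T = R O S O T" by (simp only: O_assoc absorb)
  qed
  have Q: "T O S O R \<in> G"
  proof (rule idem)
    show "T O S O R \<in> hom_rels K m n" by (rule hom_rels_comp[OF K T hom_rels_comp[OF K Sh R]])
    show "(T O S O R) O S O T O S O R = T O S O R" by (simp only: O_assoc reg)
  qed
  have "(R O S O T) O S O (W O S O (T O S O R)) = R O S O T O (S O W O S) O T O S O R"
    by (simp only: O_assoc)
  also have "\<dots> = R"
    unfolding SWS by (simp only: O_assoc absorb reg)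
  finally have "(R O S O T) O S O (W O S O (T O S O R)) = R" .
  then show ?thesis using mult[OF P mult[OF W Q]] unfolding R_def by simp
qed

text \<open>
  From \<open>R O S O R = R\<close> the endomorphism \<open>B\<inverse> O L\<close> of \<open>r\<close> is a right inverse of \<open>M\<inverse> O A\<close>. By
  finiteness it is a two-sided inverse, which is what \<open>S O R O S = S\<close> says.
\<close>

lemma top_rank_idempotent:
  assumes K: "diagram_category K"
    and L: "L \<in> retracts K m r" and M: "M \<in> retracts K n r"
    and A: "A \<in> retracts K n r" and B: "B \<in> retracts K m r"
    and R: "R = L O M\<inverse>" and S: "S = A O B\<inverse>" and idem: "R O S O R = R"
  shows "S O R O S = S"
proof -
  note Ah = retractsD(1)[OF A] and Bh = retractsD(1)[OF B]
    and Lh = retractsD(1)[OF L] and Mh = retractsD(1)[OF M]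
  have MA: "M\<inverse> O A \<in> hom_rels K r r" by (rule hom_rels_comp[OF K hom_rels_converse[OF K Mh] Ah])
  have BL: "B\<inverse> O L \<in> hom_rels K r r" by (rule hom_rels_comp[OF K hom_rels_converse[OF K Bh] Lh])
  have Bs: "B\<inverse> \<in> hom_rels K r m" by (rule hom_rels_converse[OF K Bh])
  have MABL: "(M\<inverse> O A) O (B\<inverse> O L) \<in> hom_rels K r r" by (rule hom_rels_comp[OF K MA BL])
  have "(M\<inverse> O A) O (B\<inverse> O L) = (L\<inverse> O L) O ((M\<inverse> O A) O (B\<inverse> O L)) O (M\<inverse> O M)"
    unfolding retractsD(2)[OF L] retractsD(2)[OF M] unit_rel_right[OF MABL]
      unit_rel_left[OF MABL] ..
  also have "\<dots> = L\<inverse> O (R O S O R) O M" unfolding R S by (simp only: O_assoc)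
  also have "\<dots> = (L\<inverse> O L) O (M\<inverse> O M)" unfolding idem unfolding R by (simp only: O_assoc)
  also have "\<dots> = unit_rel r" unfolding retractsD(2)[OF L] retractsD(2)[OF M] by blast
  finally have "(B\<inverse> O L) O (M\<inverse> O A) = unit_rel r"
    by (rule hom_rels_one_sided_inverse[OF K MA BL])
  have "S O R O S = A O ((B\<inverse> O L) O (M\<inverse> O A)) O B\<inverse>" unfolding R S by (simp only: O_assoc)
  also have "\<dots> = S"
    unfolding \<open>(B\<inverse> O L) O (M\<inverse> O A) = unit_rel r\<close> unit_rel_left[OF Bs] S ..
  finally show ?thesis .
qed

text \<open>
  Sandwich regular elements are closed under the sandwich product, since \<open>X = S O R O S O R' O S\<close> has
  an inverse in the category.
\<close>

lemma regular_product:
  assumes K: "diagram_category K" and S: "S \<in> hom_rels K n m"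
    and R: "R \<in> hom_rels K m n" "T \<in> hom_rels K m n" "R = R O S O T O S O R"
    and R': "R' \<in> hom_rels K m n" "T' \<in> hom_rels K m n" "R' = R' O S O T' O S O R'"
  shows "\<exists>T'' \<in> hom_rels K m n. (R O S O R') O S O T'' O S O (R O S O R') = R O S O R'"
proof -
  define X where "X = S O R O S O R' O S"
  have X: "X \<in> hom_rels K n m"
    unfolding X_def by (intro hom_rels_comp[OF K S] hom_rels_comp[OF K R(1)] hom_rels_comp[OF K R'(1)] S)
  have l: "R O S O T O S O R O Z = R O Z" for Z
    using arg_cong[OF R(3), of "\<lambda>Y. Y O Z"] by (simp only: O_assoc)
  have "(R O S O R') O S O X\<inverse> O S O (R O S O R') =
      (R O S O T O S O R O S O R') O S O X\<inverse> O S O (R O S O R' O S O T' O S O R')"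
    unfolding l R'(3)[symmetric] ..
  also have "\<dots> = R O S O T O (X O X\<inverse> O X) O T' O S O R'" unfolding X_def by (simp only: O_assoc)
  also have "\<dots> = R O S O T O X O T' O S O R'" unfolding hom_rels_regular[OF K X] ..
  also have "\<dots> = R O S O R'" unfolding X_def O_assoc l R'(3)[symmetric] ..
  finally show ?thesis using hom_rels_converse[OF K X] by blast
qed

section \<open>Idempotent-generated sandwich semigroups\<close>

theorem theorem5p17:
  fixes K :: "partition set" and m n r :: nat and \<sigma> :: partition
  assumes "K = partition_category \<or> K = brauer_category"
    and "\<sigma> \<in> homset K n m"
    and "r = rank \<sigma>"
  shows "idempotent_generated (homset K m n) (sandwich \<sigma>) =
    V_sandwich K m n \<sigma> \<union> (P_sandwich K m n \<sigma> - D_sandwich K m n \<sigma> r)"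
proof -
  have K: "diagram_category K" using assms(1) unfolding diagram_category_def .
  define S where "S = rel \<sigma>"
  have S: "S \<in> hom_rels K n m" using assms(2) unfolding S_def hom_rels_def by blast
  obtain A B where A: "A \<in> retracts K n r" and B: "B \<in> retracts K m r" and AB: "S = A O B\<inverse>"
    unfolding S_def assms(3) by (rule rel_as_retracts[OF K assms(2)])
  have hom: "rel \<alpha> \<in> hom_rels K m n" if "\<alpha> \<in> homset K m n" for \<alpha>
    using that unfolding hom_rels_def by blast
  have sw: "sandwich \<sigma> \<alpha> \<beta> \<in> homset K m n" "rel (sandwich \<sigma> \<alpha> \<beta>) = rel \<alpha> O S O rel \<beta>"
    if "\<alpha> \<in> homset K m n" "\<beta> \<in> homset K m n" for \<alpha> \<beta>
  proof -
    have "\<alpha> \<cdot> \<sigma> \<in> homset K m m" by (rule part_mult_in_homset[OF K that(1) assms(2)])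
    then show "sandwich \<sigma> \<alpha> \<beta> \<in> homset K m n" "rel (sandwich \<sigma> \<alpha> \<beta>) = rel \<alpha> O S O rel \<beta>"
      unfolding sandwich_def S_def
      using part_mult_in_homset[OF K _ that(2)] rel_mult_homset[OF _ that(2)]
        rel_mult_homset[OF that(1) assms(2)] by (auto simp: O_assoc)
  qed
  have eq_iff: "\<alpha> = \<beta> \<longleftrightarrow> rel \<alpha> = rel \<beta>" if "\<alpha> \<in> homset K k l" "\<beta> \<in> homset K k l" for \<alpha> \<beta> k l
    using that rel_inject unfolding homset_def by blast
  have idem_iff: "\<alpha> \<in> idempotents (homset K m n) (sandwich \<sigma>) \<longleftrightarrow>
      \<alpha> \<in> homset K m n \<and> rel \<alpha> O S O rel \<alpha> = rel \<alpha>" for \<alpha>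
  proof -
    have "sandwich \<sigma> \<alpha> \<alpha> = \<alpha> \<longleftrightarrow> rel \<alpha> O S O rel \<alpha> = rel \<alpha>" if "\<alpha> \<in> homset K m n"
      using eq_iff[OF sw(1)[OF that that] that] unfolding sw(2)[OF that that] .
    then show ?thesis unfolding idempotents_def by blast
  qed
  have P_iff: "\<alpha> \<in> P_sandwich K m n \<sigma> \<longleftrightarrow> \<alpha> \<in> homset K m n \<and>
      (\<exists>T \<in> hom_rels K m n. rel \<alpha> O S O T O S O rel \<alpha> = rel \<alpha>)" for \<alpha>
  proof -
    have reg: "\<alpha> = sandwich \<sigma> (sandwich \<sigma> \<alpha> \<beta>) \<alpha> \<longleftrightarrow> rel \<alpha> O S O rel \<beta> O S O rel \<alpha> = rel \<alpha>"
      if "\<alpha> \<in> homset K m n" "\<beta> \<in> homset K m n" for \<beta>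
      using eq_iff[OF that(1) sw(1)[OF sw(1)[OF that] that(1)]]
      unfolding sw(2)[OF sw(1)[OF that] that(1)] sw(2)[OF that] O_assoc by metis
    show ?thesis
    proof (cases "\<alpha> \<in> homset K m n")
      case True
      have "(\<exists>\<beta> \<in> homset K m n. \<alpha> = sandwich \<sigma> (sandwich \<sigma> \<alpha> \<beta>) \<alpha>) \<longleftrightarrow>
          (\<exists>\<beta> \<in> homset K m n. rel \<alpha> O S O rel \<beta> O S O rel \<alpha> = rel \<alpha>)"
        by (intro bex_cong refl) (rule reg[OF True])
      then show ?thesis using True unfolding P_sandwich_def Reg_def hom_rels_def by simp
    qed (simp add: P_sandwich_def Reg_def)
  qed
  have PE: thesis
    if "\<alpha> \<in> P_sandwich K m n \<sigma>"
      and "\<And>T. \<alpha> \<in> homset K m n \<Longrightarrow> T \<in> hom_rels K m n \<Longrightarrow>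
        rel \<alpha> = rel \<alpha> O S O T O S O rel \<alpha> \<Longrightarrow> thesis" for \<alpha> thesis
    using that(1) unfolding P_iff by (elim conjE bexE) (rule that(2), assumption+, rule sym)
  have V_iff: "\<alpha> \<in> V_sandwich K m n \<sigma> \<longleftrightarrow> \<alpha> \<in> homset K m n \<and>
      S O rel \<alpha> O S = S \<and> rel \<alpha> O S O rel \<alpha> = rel \<alpha>" for \<alpha>
  proof -
    have "\<sigma> = \<sigma> \<cdot> \<alpha> \<cdot> \<sigma> \<longleftrightarrow> S O rel \<alpha> O S = S" if \<alpha>: "\<alpha> \<in> homset K m n"
    proof -
      have \<sigma>\<alpha>: "\<sigma> \<cdot> \<alpha> \<in> homset K n n" by (rule part_mult_in_homset[OF K assms(2) \<alpha>])
      show ?thesis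
        using eq_iff[OF assms(2) part_mult_in_homset[OF K \<sigma>\<alpha> assms(2)]]
        unfolding rel_mult_homset[OF \<sigma>\<alpha> assms(2)] rel_mult_homset[OF assms(2) \<alpha>] S_def O_assoc
        by metis
    qed
    moreover have "\<alpha> = \<alpha> \<cdot> \<sigma> \<cdot> \<alpha> \<longleftrightarrow> rel \<alpha> O S O rel \<alpha> = rel \<alpha>" if \<alpha>: "\<alpha> \<in> homset K m n"
      using eq_iff[OF \<alpha> sw(1)[OF \<alpha> \<alpha>]] unfolding sw(2)[OF \<alpha> \<alpha>] unfolding sandwich_def by metis
    ultimately show ?thesis unfolding V_sandwich_def by blast
  qed
  have V_P: "\<alpha> \<in> P_sandwich K m n \<sigma>"
    if \<alpha>: "\<alpha> \<in> homset K m n" and idem: "rel \<alpha> O S O rel \<alpha> = rel \<alpha>" for \<alpha>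
  proof -
    have "rel \<alpha> O S O rel \<alpha> O S O rel \<alpha> = rel \<alpha>" using idem by simp
    then show ?thesis
      unfolding P_iff using \<alpha> hom[OF \<alpha>] by (intro conjI bexI[of _ "rel \<alpha>"])
  qed
  have P_rank: "rank \<alpha> \<le> r" if P: "\<alpha> \<in> P_sandwich K m n \<sigma>" for \<alpha>
  proof -
    obtain T where \<alpha>: "\<alpha> \<in> homset K m n" and "T \<in> hom_rels K m n" and T: "rel \<alpha> = rel \<alpha> O S O T O S O rel \<alpha>"
      by (rule PE[OF P])
    show ?thesis
    proof (rule rank_le[OF K \<alpha>])
      show "rel \<alpha> O A \<in> hom_rels K m r" by (rule hom_rels_comp[OF K hom[OF \<alpha>] retractsD(1)[OF A]])
      show "rel \<alpha> = (rel \<alpha> O A) O (B\<inverse> O T O S O rel \<alpha>)" unfolding O_assoc using T unfolding AB O_assoc .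
    qed
  qed
  let ?E = "idempotent_generated (homset K m n) (sandwich \<sigma>)"
  let ?low = "P_sandwich K m n \<sigma> - D_sandwich K m n \<sigma> r"
  have low_iff: "\<alpha> \<in> ?low \<longleftrightarrow> \<alpha> \<in> P_sandwich K m n \<sigma> \<and> rank \<alpha> < r" for \<alpha>
    using P_rank[of \<alpha>] unfolding D_sandwich_def by auto
  have lowI: "\<alpha> \<in> ?low" if "\<alpha> \<in> P_sandwich K m n \<sigma>" "rank \<alpha> \<noteq> r" for \<alpha>
    using that unfolding D_sandwich_def by blast
  have E_hom: "\<alpha> \<in> homset K m n" if "\<alpha> \<in> ?E" for \<alpha>
    using that unfolding idempotent_generated_def
    by (induction rule: generated_subsemigroup.induct) (use sw(1) in \<open>auto simp: idempotents_def\<close>)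
  show ?thesis
  proof (intro set_eqI iffI)
    fix \<alpha> assume "\<alpha> \<in> ?E"
    then show "\<alpha> \<in> V_sandwich K m n \<sigma> \<union> ?low"
      unfolding idempotent_generated_def
    proof (induction rule: generated_subsemigroup.induct)
      case (generator \<alpha>)
      then have \<alpha>: "\<alpha> \<in> homset K m n" and idem: "rel \<alpha> O S O rel \<alpha> = rel \<alpha>"
        unfolding idem_iff by blast+
      note P = V_P[OF \<alpha> idem]
      show ?case
      proof (cases "rank \<alpha> = r")
        case True
        obtain L M where L: "L \<in> retracts K m r" and M: "M \<in> retracts K n r" and LM: "rel \<alpha> = L O M\<inverse>"
          by (rule rel_as_retracts[OF K \<alpha>, unfolded True])
        have "S O rel \<alpha> O S = S" by (rule top_rank_idempotent[OF K L M A B LM AB idem])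
        then show ?thesis using V_iff[of \<alpha>] \<alpha> idem by simp
      next
        case False
        then show ?thesis using lowI[OF P] by blast
      qed
    next
      case (closed \<alpha> \<beta>)
      have P: "\<alpha> \<in> P_sandwich K m n \<sigma>" "\<beta> \<in> P_sandwich K m n \<sigma>"
        using closed.IH V_P V_iff by blast+
      obtain T where \<alpha>: "\<alpha> \<in> homset K m n" and T: "T \<in> hom_rels K m n" "rel \<alpha> = rel \<alpha> O S O T O S O rel \<alpha>"
        by (rule PE[OF P(1)])
      obtain T' where \<beta>: "\<beta> \<in> homset K m n" and T': "T' \<in> hom_rels K m n" "rel \<beta> = rel \<beta> O S O T' O S O rel \<beta>"
        by (rule PE[OF P(2)])
      note \<alpha>\<beta> = sw[OF \<alpha> \<beta>]
      have P': "sandwich \<sigma> \<alpha> \<beta> \<in> P_sandwich K m n \<sigma>"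
        unfolding P_iff \<alpha>\<beta>(2)
        by (rule conjI[OF \<alpha>\<beta>(1) regular_product[OF K S hom[OF \<alpha>] T hom[OF \<beta>] T']])
      show ?case
      proof (cases "rank (sandwich \<sigma> \<alpha> \<beta>) = r")
        case False
        then show ?thesis using lowI[OF P'] by blast
      next
        case True
        have "r \<le> rank \<alpha>"
        proof -
          obtain L M where L: "L \<in> retracts K m (rank \<alpha>)" and "rel \<alpha> = L O M\<inverse>"
            by (rule rel_as_retracts[OF K \<alpha>])
          then have "rel (sandwich \<sigma> \<alpha> \<beta>) = L O (M\<inverse> O S O rel \<beta>)"
            unfolding \<alpha>\<beta>(2) by (simp only: O_assoc)
          from rank_le[OF K \<alpha>\<beta>(1) retractsD(1)[OF L] this] show ?thesis using True by simp
        qed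
        moreover have "r \<le> rank \<beta>"
        proof -
          obtain L M where L: "L \<in> retracts K m (rank \<beta>)" and "rel \<beta> = L O M\<inverse>"
            by (rule rel_as_retracts[OF K \<beta>])
          then have "rel (sandwich \<sigma> \<alpha> \<beta>) = (rel \<alpha> O S O L) O M\<inverse>"
            unfolding \<alpha>\<beta>(2) by (simp only: O_assoc)
          moreover have "rel \<alpha> O S O L \<in> hom_rels K m (rank \<beta>)"
            by (intro hom_rels_comp[OF K hom[OF \<alpha>]] hom_rels_comp[OF K S] retractsD(1)[OF L])
          ultimately show ?thesis using rank_le[OF K \<alpha>\<beta>(1)] unfolding True by metis
        qed
        ultimately have V: "\<alpha> \<in> V_sandwich K m n \<sigma>" "\<beta> \<in> V_sandwich K m n \<sigma>"
          using closed.IH low_iff by auto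
        then have a: "S O rel \<alpha> O S = S" "rel \<alpha> O S O rel \<alpha> = rel \<alpha>"
          and b: "S O rel \<beta> O S = S" "rel \<beta> O S O rel \<beta> = rel \<beta>"
          unfolding V_iff by blast+
        have a': "S O rel \<alpha> O S O X = S O X" for X
          using arg_cong[OF a(1), of "\<lambda>Y. Y O X"] by (simp only: O_assoc)
        have b': "S O rel \<beta> O S O X = S O X" for X
          using arg_cong[OF b(1), of "\<lambda>Y. Y O X"] by (simp only: O_assoc)
        have "sandwich \<sigma> \<alpha> \<beta> \<in> V_sandwich K m n \<sigma>"
          unfolding V_iff \<alpha>\<beta>(2) by (simp only: O_assoc a' b' a b \<alpha>\<beta>(1) simp_thms)
        then show ?thesis by blast
      qed
    qed
  next
    fix \<alpha> assume "\<alpha> \<in> V_sandwich K m n \<sigma> \<union> ?low"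
    then show "\<alpha> \<in> ?E"
    proof
      assume "\<alpha> \<in> V_sandwich K m n \<sigma>"
      then have "\<alpha> \<in> idempotents (homset K m n) (sandwich \<sigma>)" unfolding V_iff idem_iff by blast
      then show ?thesis
        unfolding idempotent_generated_def by (rule generated_subsemigroup.generator)
    next
      assume "\<alpha> \<in> ?low"
      then have P: "\<alpha> \<in> P_sandwich K m n \<sigma>" and lt: "rank \<alpha> < r" using low_iff by blast+
      obtain T where \<alpha>: "\<alpha> \<in> homset K m n" and T: "T \<in> hom_rels K m n"
        "rel \<alpha> = rel \<alpha> O S O T O S O rel \<alpha>"
        by (rule PE[OF P])
      have "rel \<alpha> \<in> rel ` ?E"
      proof (rule low_rank_generated[OF K \<alpha> lt A B AB T])
        fix R assume R: "R \<in> hom_rels K m n" "R O S O R = R"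
        then obtain \<beta> where \<beta>: "\<beta> \<in> homset K m n" "R = rel \<beta>" unfolding hom_rels_def by blast
        then have "\<beta> \<in> ?E"
          using R(2) idem_iff unfolding idempotent_generated_def
          by (blast intro: generated_subsemigroup.generator)
        then show "R \<in> rel ` ?E" using \<beta>(2) by blast
      next
        fix R R' assume "R \<in> rel ` ?E" "R' \<in> rel ` ?E"
        then obtain \<beta> \<gamma> where \<beta>: "\<beta> \<in> ?E" "R = rel \<beta>" and \<gamma>: "\<gamma> \<in> ?E" "R' = rel \<gamma>" by blast
        have "R O S O R' = rel (sandwich \<sigma> \<beta> \<gamma>)"
          using sw(2)[OF E_hom[OF \<beta>(1)] E_hom[OF \<gamma>(1)]] \<beta> \<gamma> by simp
        moreover have "sandwich \<sigma> \<beta> \<gamma> \<in> ?E"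
          using \<beta>(1) \<gamma>(1) unfolding idempotent_generated_def by (rule generated_subsemigroup.closed)
        ultimately show "R O S O R' \<in> rel ` ?E" by blast
      qed
      then obtain \<beta> where \<beta>: "\<beta> \<in> ?E" "rel \<alpha> = rel \<beta>" by blast
      then have "\<alpha> = \<beta>" using eq_iff[OF \<alpha> E_hom] by blast
      then show ?thesis using \<beta>(1) by simp
    qed
  qed
qed

end
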